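(* Let $f\colon[0,1]\to\mathbb{R}$ be a Lipschitz continuous function such that $f(0)=f(1)=0$ and there exists $\alpha\in\,]0,1[$ with $f(\alpha)=0$, $f(s)<0$ for all $s\in\,]0,\alpha[$ and $f(s)>0$ for all $s\in\,]\alpha,1[$. Let $F(v)=\int_0^v f(s)\,\mathrm{d}s$. Let $\delta>0$ be fixed, let $t_0\in\mathbb{R}$ and $c_1,c_2>0$, and let $q\equiv c_1$ in $]-\infty,t_0[$ and $q\equiv c_2$ in $[t_0,+\infty[$. Consider the equation $$\delta\left(\frac{v'}{\sqrt{1-(v')^2}}\right)'+q(t)f(v)=0,\quad t\in\mathbb{R}.\qquad (E)$$ (I) Assume $F(1)>0$. Then: - if $c_2>c_1$, then any solution of $(E)$ such that $v(-\infty)=0$ is definitively periodic, that is, $v(t)=v(t+T)$ for every $t\in[t_0,+\infty[$ for a suitable $T>0$; - if $c_2=c_1$, then there exists a homoclinic solution of $(E)$, unique up to $t$-translation; - if $c_2<c_1$ and $c_2\neq c_1\dfrac{-F(\rho)}{F(1)-F(\rho)}$ for all $\rho\in\,]0,\alpha]$, then all the solutions of $(E)$ for which $v(-\infty)=0$ take either value $0$ or value $1$ (with nonzero derivative) in finite time; - if $c_2=c_1\dfrac{-F(\rho)}{F(1)-F(\rho)}$ for some $\rho\in\,]0,\alpha]$, then there exists a heteroclinic solution of $(E)$. (II) Assume instead $F(1)=0$. Then: - if $c_2>c_1$, then any solution of $(E)$ such that $v(-\infty)=0$ is definitively periodic, that is, $v(t)=v(t+T)$ for every $t\in[t_0,+\infty[$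 for a suitable $T>0$ (in particular, there are no homoclinic solutions of $(E)$); - if $c_2=c_1$, then there exists a heteroclinic solution of $(E)$; - if $c_2<c_1$, then all the solutions of $(E)$ for which $v(-\infty)=0$ take either value $0$ or value $1$ (with nonzero derivative) in finite time.
   Context: A solution of $(E)$ is a continuously differentiable function $v\colon\mathbb{R}\to[0,1]$ with $v'$ absolutely continuous which satisfies the equation almost everywhere. Whenever useful (in particular when a solution reaches $0$ or $1$ with nonzero derivative and so leaves $[0,1]$), $f$ is extended continuously to $\mathbb{R}$ by $f(s)=0$ for $s\in\mathbb{R}\setminus[0,1]$, and solutions are understood for the extended equation. A heteroclinic solution is a solution $v$ which is strictly increasing with $v(-\infty)=0$ and $v(+\infty)=1$. A homoclinic solution is a solution $v$ with $v(\pm\infty)=0$ which displays a unique change of monotonicity. Here $v(\pm\infty)$ denotes the limit of $v(t)$ as $t\to\pm\infty$.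
   Formalization: In (I), for c₂>c₁ and c₂<c₁, solutions strictly increasing up to t₀ and strictly decreasing to 0 after it (homoclinics peaking exactly at t₀) are excluded, as they violate the claims; where solutions take value 0 or 1 with nonzero derivative, v≡0 is excluded. *)

theory Defs
  imports "HOL-Analysis.Analysis"
begin

text \<open>
  The epsilon-delta notion of absolute continuity of a function on a compact interval; the
  library only has absolute continuity of measures.
\<close>

definition abs_continuous_on_interval :: "real \<Rightarrow> real \<Rightarrow> (real \<Rightarrow> real) \<Rightarrow> bool" where
  "abs_continuous_on_interval a b g \<longleftrightarrow>
    (\<forall>\<epsilon>>0. \<exists>\<eta>>0. \<forall>(n::nat) (x::nat \<Rightarrow> real) (y::nat \<Rightarrow> real).
      (\<forall>i<n. a \<le> x i \<and> x i \<le> y i \<and> y i \<le> b) \<and>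
      disjoint_family_on (\<lambda>i. {x i<..<y i}) {..<n} \<and>
      (\<Sum>i<n. y i - x i) < \<eta>
      \<longrightarrow> (\<Sum>i<n. \<bar>g (y i) - g (x i)\<bar>) < \<epsilon>)"

text \<open>On the whole line absolute continuity is understood locally, as usual.\<close>

definition abs_continuous :: "(real \<Rightarrow> real) \<Rightarrow> bool" where
  "abs_continuous g \<longleftrightarrow> (\<forall>a b. a \<le> b \<longrightarrow> abs_continuous_on_interval a b g)"

definition zero_extension :: "(real \<Rightarrow> real) \<Rightarrow> real \<Rightarrow> real" where
  "zero_extension f s = (if s \<in> {0..1} then f s else 0)"

text \<open>
  Real-valued solutions of \<open>\<delta> (v' / sqrt (1 - v'^2))' + q(t) f(v) = 0\<close>, with \<open>f\<close> replaced by its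
  extension by zero.  The condition \<open>\<bar>v'\<bar> < 1\<close>, implicit in the equation, is spelled out since
  square root and division are total functions here.
\<close>

definition extended_solution ::
    "real \<Rightarrow> (real \<Rightarrow> real) \<Rightarrow> (real \<Rightarrow> real) \<Rightarrow> (real \<Rightarrow> real) \<Rightarrow> bool" where
  "extended_solution \<delta> q f v \<longleftrightarrow>
    v C1_differentiable_on UNIV \<and>
    abs_continuous (deriv v) \<and>
    (\<forall>t. \<bar>deriv v t\<bar> < 1) \<and>
    (AE t in lebesgue. \<exists>D.
      ((\<lambda>s. deriv v s / sqrt (1 - (deriv v s)\<^sup>2)) has_real_derivative D) (at t) \<and>
      \<delta> * D + q t * zero_extension f (v t) = 0)"

text \<open>Solutions with values in \<open>[0,1]\<close>; for these the extension of \<open>f\<close> plays no role.\<close>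

definition solution ::
    "real \<Rightarrow> (real \<Rightarrow> real) \<Rightarrow> (real \<Rightarrow> real) \<Rightarrow> (real \<Rightarrow> real) \<Rightarrow> bool" where
  "solution \<delta> q f v \<longleftrightarrow> extended_solution \<delta> q f v \<and> range v \<subseteq> {0..1}"

definition heteroclinic ::
    "real \<Rightarrow> (real \<Rightarrow> real) \<Rightarrow> (real \<Rightarrow> real) \<Rightarrow> (real \<Rightarrow> real) \<Rightarrow> bool" where
  "heteroclinic \<delta> q f v \<longleftrightarrow>
    solution \<delta> q f v \<and> strict_mono v \<and> (v \<longlongrightarrow> 0) at_bot \<and> (v \<longlongrightarrow> 1) at_top"

text \<open>
  Since \<open>v \<ge> 0\<close> and \<open>v\<close> vanishes at both infinities, a unique change of monotonicity can only be
  from increasing to decreasing; it takes place at the peak \<open>p\<close>.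
  The peak is recorded because, if \<open>F 1 > 0\<close>, the zero-energy homoclinic orbits for any two constant
  values of \<open>q\<close> have the same maximum; glued at a peak placed at the jump of \<open>q\<close>, they form a
  homoclinic solution, which is neither eventually periodic nor leaves \<open>]0,1[\<close>.
\<close>

definition homoclinic_with_peak ::
    "real \<Rightarrow> (real \<Rightarrow> real) \<Rightarrow> (real \<Rightarrow> real) \<Rightarrow> real \<Rightarrow> (real \<Rightarrow> real) \<Rightarrow> bool" where
  "homoclinic_with_peak \<delta> q f p v \<longleftrightarrow>
    solution \<delta> q f v \<and> (v \<longlongrightarrow> 0) at_bot \<and> (v \<longlongrightarrow> 0) at_top \<and>
    strict_mono_on {..p} v \<and> strict_antimono_on {p..} v"

definition homoclinic ::
    "real \<Rightarrow> (real \<Rightarrow> real) \<Rightarrow> (real \<Rightarrow> real) \<Rightarrow> (real \<Rightarrow> real) \<Rightarrow> bool" where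
  "homoclinic \<delta> q f v \<longleftrightarrow> (\<exists>p. homoclinic_with_peak \<delta> q f p v)"

definition periodic_from :: "real \<Rightarrow> (real \<Rightarrow> real) \<Rightarrow> bool" where
  "periodic_from t\<^sub>0 v \<longleftrightarrow> (\<exists>T>0. \<forall>t\<ge>t\<^sub>0. v t = v (t + T))"

definition exits_transversally :: "(real \<Rightarrow> real) \<Rightarrow> bool" where
  "exits_transversally v \<longleftrightarrow> (\<exists>t. (v t = 0 \<or> v t = 1) \<and> deriv v t \<noteq> 0)"

end

theory Submission
  imports Defs
begin

text \<open>
  Put \<open>w = v' / sqrt (1 - v'^2)\<close>.  On each side of \<open>t\<^sub>0\<close> the equation is the autonomous Lipschitz
  system \<open>v' = w / sqrt (1 + w^2)\<close>, \<open>w' = - k f(v)\<close> with \<open>k = c / \<delta>\<close>, which conserves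
  \<open>sqrt (1 + w^2) - 1 + k F(v)\<close>.  A solution with \<open>v(-\<infinity>) = 0\<close> has energy \<open>0\<close> before \<open>t\<^sub>0\<close>, hence
  energy \<open>(k\<^sub>2 - k\<^sub>1) F(v t\<^sub>0)\<close> after \<open>t\<^sub>0\<close>, where \<open>F(v t\<^sub>0) \<le> 0\<close>, with equality only for the trivial
  solution and for a turning point at \<open>t\<^sub>0\<close>.  A bounded orbit on which \<open>w\<close> does not vanish converges
  to an equilibrium of the same energy, that is, to \<open>0\<close>, \<open>\<alpha>\<close> or \<open>1\<close>.  So on a negative energy level
  \<open>w\<close> has zeros at arbitrarily late times and the orbit is periodic, while on a positive level other
  than that of \<open>1\<close> the zeros of \<open>w\<close> are transversal in one direction, so there is at most one,
  and the orbit cannot stay in \<open>]0,1[\<close>.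
\<close>

section \<open>Absolutely continuous functions\<close>

text \<open>The equation is given only almost everywhere, so phase plane arguments do not apply to
  it directly. On a compact interval the continuous function v' stays away from -1 and 1, hence w is
  absolutely continuous there; comparison with an antiderivative of the continuous function f(v(t))
  shows that w solves its equation classically on each side of the jump. Extending f by zero and
  passing to w removes the singularity at |v'| = 1 and makes the vector field globally Lipschitz, so
  orbits are global and unique even after leaving [0,1]. Both cases of the theorem share one
  analysis through the point \<beta> in ]\<alpha>,1] where F returns to 0. If F(1) > 0, then \<beta>
  < 1 is a turning point of the zero level; if F(1) = 0, then \<beta> = 1 is an equilibrium, and the
  exceptional peak at the jump cannot occur. The ratio in the theorem is a comparison of energies: a
  crossing of the jump at height \<rho> lands on the level of 1 iff
  \<open>(k\<^sub>2 - k\<^sub>1) * F \<rho> = k\<^sub>2 * F 1\<close>. Testing \<rho> up to \<alpha>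
  suffices, since F takes on ]\<alpha>,\<beta>[ only values that it takes on ]0,\<alpha>[.\<close>

lemma abs_continuous_on_interval_lipschitz_compose:
  assumes ac: "abs_continuous_on_interval a b g" and lip: "C-lipschitz_on (g ` {a..b}) h"
  shows "abs_continuous_on_interval a b (\<lambda>t. h (g t))"
  unfolding abs_continuous_on_interval_def
proof (intro allI impI)
  fix \<epsilon> :: real assume \<epsilon>: "\<epsilon> > 0"
  have C: "C \<ge> 0" using lip by (rule lipschitz_on_nonneg)
  \<comment> \<open>Dividing by \<open>C + 1\<close> instead of \<open>C\<close> covers a vanishing
    Lipschitz constant.\<close>
  obtain \<eta> where \<eta>: "\<eta> > 0" and *: "\<And>(n::nat) x y. (\<forall>i<n. a \<le> x i \<and> x i \<le> y i \<and> y i \<le> b) \<and>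
      disjoint_family_on (\<lambda>i. {x i<..<y i}) {..<n} \<and> (\<Sum>i<n. y i - x i) < \<eta>
      \<Longrightarrow> (\<Sum>i<n. \<bar>g (y i) - g (x i)\<bar>) < \<epsilon> / (C + 1)"
    using ac[unfolded abs_continuous_on_interval_def, rule_format, of "\<epsilon> / (C + 1)"] \<epsilon> C by fastforce
  show "\<exists>\<eta>>0. \<forall>(n::nat) x y. (\<forall>i<n. a \<le> x i \<and> x i \<le> y i \<and> y i \<le> b) \<and>
      disjoint_family_on (\<lambda>i. {x i<..<y i}) {..<n} \<and> (\<Sum>i<n. y i - x i) < \<eta>
      \<longrightarrow> (\<Sum>i<n. \<bar>h (g (y i)) - h (g (x i))\<bar>) < \<epsilon>"
  proof (intro exI conjI allI impI)
    show "\<eta> > 0" by fact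
    fix n :: nat and x y :: "nat \<Rightarrow> real"
    assume A: "(\<forall>i<n. a \<le> x i \<and> x i \<le> y i \<and> y i \<le> b) \<and>
      disjoint_family_on (\<lambda>i. {x i<..<y i}) {..<n} \<and> (\<Sum>i<n. y i - x i) < \<eta>"
    have "(\<Sum>i<n. \<bar>h (g (y i)) - h (g (x i))\<bar>) \<le> (\<Sum>i<n. C * \<bar>g (y i) - g (x i)\<bar>)"
    proof (rule sum_mono)
      fix i assume "i \<in> {..<n}"
      then have "x i \<in> {a..b}" "y i \<in> {a..b}" using A by force+
      then show "\<bar>h (g (y i)) - h (g (x i))\<bar> \<le> C * \<bar>g (y i) - g (x i)\<bar>"
        using lipschitz_onD[OF lip, of "g (y i)" "g (x i)"] by (auto simp: dist_real_def)
    qed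
    also have "\<dots> \<le> (C + 1) * (\<Sum>i<n. \<bar>g (y i) - g (x i)\<bar>)"
      using C by (simp add: sum_distrib_left[symmetric] mult_right_mono sum_nonneg)
    also have "\<dots> < \<epsilon>"
      using *[OF A] C by (simp add: field_simps)
    finally show "(\<Sum>i<n. \<bar>h (g (y i)) - h (g (x i))\<bar>) < \<epsilon>" .
  qed
qed

lemma lipschitz_imp_abs_continuous_on_interval:
  assumes "C-lipschitz_on {a..b} h"
  shows "abs_continuous_on_interval a b h"
proof -
  have "abs_continuous_on_interval a b (\<lambda>t. t)"
    unfolding abs_continuous_on_interval_def
  proof (intro allI impI)
    fix \<epsilon> :: real assume "\<epsilon> > 0"
    moreover have "(\<Sum>i<n. \<bar>y i - x i\<bar>) = (\<Sum>i<n. y i - x i)" if "\<forall>i<n. a \<le> x i \<and> x i \<le> y i \<and> y i \<le> b"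
      for n and x y :: "nat \<Rightarrow> real"
      using that by (intro sum.cong) auto
    ultimately show "\<exists>\<eta>>0. \<forall>(n::nat) x y. (\<forall>i<n. a \<le> x i \<and> x i \<le> y i \<and> y i \<le> b) \<and>
      disjoint_family_on (\<lambda>i. {x i<..<y i}) {..<n} \<and> (\<Sum>i<n. y i - x i) < \<eta>
      \<longrightarrow> (\<Sum>i<n. \<bar>y i - x i\<bar>) < \<epsilon>"
      by (intro exI[of _ \<epsilon>]) auto
  qed
  from abs_continuous_on_interval_lipschitz_compose[OF this, of C h] assms show ?thesis by simp
qed

lemma abs_continuous_on_interval_diff:
  assumes g: "abs_continuous_on_interval a b g" and h: "abs_continuous_on_interval a b h"
  shows "abs_continuous_on_interval a b (\<lambda>t. g t - h t)"
  unfolding abs_continuous_on_interval_def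
proof (intro allI impI)
  fix \<epsilon> :: real assume \<epsilon>: "\<epsilon> > 0"
  let ?P = "\<lambda>\<eta> (n::nat) x y. (\<forall>i<n. a \<le> x i \<and> x i \<le> y i \<and> y i \<le> b) \<and>
      disjoint_family_on (\<lambda>i. {x i<..<y i}) {..<n} \<and> (\<Sum>i<n. y i - x i) < \<eta>"
  obtain \<eta>1 where 1: "\<eta>1 > 0" "\<And>n x y. ?P \<eta>1 n x y \<Longrightarrow> (\<Sum>i<n. \<bar>g (y i) - g (x i)\<bar>) < \<epsilon> / 2"
    using g[unfolded abs_continuous_on_interval_def, rule_format, of "\<epsilon> / 2"] \<epsilon> by fastforce
  obtain \<eta>2 where 2: "\<eta>2 > 0" "\<And>n x y. ?P \<eta>2 n x y \<Longrightarrow> (\<Sum>i<n. \<bar>h (y i) - h (x i)\<bar>) < \<epsilon> / 2"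
    using h[unfolded abs_continuous_on_interval_def, rule_format, of "\<epsilon> / 2"] \<epsilon> by fastforce
  show "\<exists>\<eta>>0. \<forall>n x y. ?P \<eta> n x y \<longrightarrow> (\<Sum>i<n. \<bar>g (y i) - h (y i) - (g (x i) - h (x i))\<bar>) < \<epsilon>"
  proof (intro exI conjI allI impI)
    show "min \<eta>1 \<eta>2 > 0" using 1 2 by simp
    fix n :: nat and x y :: "nat \<Rightarrow> real"
    assume A: "?P (min \<eta>1 \<eta>2) n x y"
    have "(\<Sum>i<n. \<bar>g (y i) - h (y i) - (g (x i) - h (x i))\<bar>)
        \<le> (\<Sum>i<n. \<bar>g (y i) - g (x i)\<bar> + \<bar>h (y i) - h (x i)\<bar>)"
      by (rule sum_mono) linarith
    also have "\<dots> < \<epsilon> / 2 + \<epsilon> / 2"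
      unfolding sum.distrib using A by (intro add_strict_mono 1 2) auto
    finally show "(\<Sum>i<n. \<bar>g (y i) - h (y i) - (g (x i) - h (x i))\<bar>) < \<epsilon>" by simp
  qed
qed

text \<open>The intervals of a fine tagged division whose tags lie in the exceptional null set are
  controlled by absolute continuity, all others by the vanishing derivative.\<close>

lemma abs_continuous_on_interval_deriv_zero_imp_eq:
  assumes ab: "a \<le> b" and ac: "abs_continuous_on_interval a b h"
    and ae: "AE t in lebesgue. t \<in> {a<..<b} \<longrightarrow> (h has_real_derivative 0) (at t)"
  shows "h b = h a"
proof -
  obtain N0 where N0: "N0 \<in> null_sets lebesgue"
    "{t. \<not> (t \<in> {a<..<b} \<longrightarrow> (h has_real_derivative 0) (at t))} \<subseteq> N0"
    using ae by (auto simp: eventually_ae_filter)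
  \<comment> \<open>The almost-everywhere hypothesis is silent at the end points, which may be tags;
    they are treated as exceptional.\<close>
  define N where "N = N0 \<union> {a, b}"
  have N: "N \<in> null_sets lebesgue"
    unfolding N_def using N0(1)
    by (metis negligible_Un negligible_iff_null_sets negligible_insert negligible_empty)
  have der: "(h has_real_derivative 0) (at t)" if "t \<in> {a..b}" "t \<notin> N" for t
    using that N0(2) by (force simp: N_def)
  have small: "\<bar>h b - h a\<bar> \<le> \<epsilon> * (b - a) + \<epsilon>" if \<epsilon>: "\<epsilon> > 0" for \<epsilon>
  proof -
    obtain \<eta> where \<eta>: "\<eta> > 0" and AC: "\<And>(n::nat) x y. (\<forall>i<n. a \<le> x i \<and> x i \<le> y i \<and> y i \<le> b) \<and>
        disjoint_family_on (\<lambda>i. {x i<..<y i}) {..<n} \<and> (\<Sum>i<n. y i - x i) < \<eta>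
        \<Longrightarrow> (\<Sum>i<n. \<bar>h (y i) - h (x i)\<bar>) < \<epsilon>"
      using ac[unfolded abs_continuous_on_interval_def, THEN spec, THEN mp, OF \<epsilon>] by (elim exE conjE) blast
    \<comment> \<open>An open set around the null set with measure below \<eta>: intervals confined
      to it have total length small enough for absolute continuity.\<close>
    obtain U where U: "open U" "N \<subseteq> U" "U - N \<in> lmeasurable" "emeasure lebesgue (U - N) < ennreal \<eta>"
      using sets_lebesgue_outer_open[OF null_setsD2[OF N] \<eta>] .
    have "emeasure lebesgue U = emeasure lebesgue (U - N)"
      using N U(1) by (intro emeasure_Diff_null_set[symmetric]) auto
    then have mU: "emeasure lebesgue U < ennreal \<eta>" using U(4) by simp
    have "\<exists>r>0. \<forall>y. \<bar>y - t\<bar> < r \<longrightarrow> \<bar>h y - h t\<bar> \<le> \<epsilon> * \<bar>y - t\<bar>" if "t \<in> {a..b}" "t \<notin> N" for t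
      using der[OF that] \<epsilon>
      unfolding has_field_derivative_def has_derivative_at_alt by auto
    then obtain r where r: "\<And>t. t \<in> {a..b} \<Longrightarrow> t \<notin> N \<Longrightarrow> r t > 0 \<and> (\<forall>y. \<bar>y - t\<bar> < r t \<longrightarrow> \<bar>h y - h t\<bar> \<le> \<epsilon> * \<bar>y - t\<bar>)"
      by metis
    \<comment> \<open>Exceptional tags force their interval into \<open>U\<close>, all others into a
      ball where the increment of \<open>h\<close> is at most \<epsilon> times the distance. Points
      outside [a,b] are never tags; \<open>UNIV\<close> only makes \<gamma> a gauge.\<close>
    define \<gamma> where "\<gamma> t = (if t \<in> N then U else if t \<in> {a..b} then ball t (r t) else UNIV)" for t
    have "gauge \<gamma>" using U(1,2) r by (auto simp: gauge_def \<gamma>_def)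
    then obtain p where p: "p tagged_division_of {a..b}" and fine: "\<gamma> fine p"
      using fine_division_exists_real by blast
    note fin = tagged_division_ofD(1)[OF p]
    have K: "t \<in> {a..b} \<and> t \<in> K \<and> {Inf K..Sup K} = K \<and> Inf K \<le> t \<and> t \<le> Sup K \<and> a \<le> Inf K \<and> Sup K \<le> b \<and> K \<subseteq> \<gamma> t"
      if tK: "(t, K) \<in> p" for t K
    proof -
      have tin: "t \<in> K" "K \<subseteq> {a..b}" using tagged_division_ofD[OF p] tK by blast+
      obtain u v where "K = cbox u v" using tagged_division_ofD(4)[OF p tK] by blast
      then have Kuv: "K = {u..v}" by simp
      then have "u \<le> v" using tin by auto
      then show ?thesis using Kuv tin fine tK by (auto simp: fine_def)
    qed
    define d where "d = (\<lambda>(t::real, K). h (Sup K) - h (Inf K))"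
    let ?p1 = "{z \<in> p. fst z \<in> N}" and ?p2 = "{z \<in> p. fst z \<notin> N}"
    have "h b - h a = sum d p"
      unfolding d_def using additive_tagged_division_1[OF ab p, of h] by simp
    also have "\<dots> = sum d ?p1 + sum d ?p2"
    proof -
      have "p = ?p1 \<union> ?p2" by blast
      then have "sum d p = sum d (?p1 \<union> ?p2)" by (rule arg_cong)
      also have "\<dots> = sum d ?p1 + sum d ?p2"
        by (rule sum.union_disjoint) (use fin in auto)
      finally show ?thesis .
    qed
    finally have split: "h b - h a = sum d ?p1 + sum d ?p2" .
    have "\<bar>sum d ?p2\<bar> \<le> (\<Sum>z\<in>?p2. \<epsilon> * (Sup (snd z) - Inf (snd z)))"
    proof (rule order_trans[OF sum_abs], rule sum_mono)
      fix z assume z: "z \<in> ?p2"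
      obtain t K' where zt: "z = (t, K')" by force
      then have tK: "(t, K') \<in> p" "t \<notin> N" using z by auto
      note k = K[OF tK(1)]
      have "Inf K' \<le> Sup K'" using k by linarith
      then have "Inf K' \<in> {Inf K'..Sup K'}" "Sup K' \<in> {Inf K'..Sup K'}" by simp_all
      then have "Inf K' \<in> K'" "Sup K' \<in> K'" using k by blast+
      then have "\<bar>Inf K' - t\<bar> < r t" "\<bar>Sup K' - t\<bar> < r t"
        using k tK(2) by (auto simp: \<gamma>_def dist_real_def abs_minus_commute)
      then have "\<bar>h (Inf K') - h t\<bar> \<le> \<epsilon> * \<bar>Inf K' - t\<bar>" "\<bar>h (Sup K') - h t\<bar> \<le> \<epsilon> * \<bar>Sup K' - t\<bar>"
        using r[of t] k tK(2) by blast+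
      \<comment> \<open>The tag lies between the end points, so the two errors add up to exactly
        \<epsilon> times the length.\<close>
      moreover have "\<epsilon> * \<bar>Inf K' - t\<bar> + \<epsilon> * \<bar>Sup K' - t\<bar> = \<epsilon> * (Sup K' - Inf K')"
        using k by (simp add: abs_if algebra_simps)
      ultimately show "\<bar>d z\<bar> \<le> \<epsilon> * (Sup (snd z) - Inf (snd z))" by (simp add: d_def zt)
    qed
    also have "\<dots> \<le> (\<Sum>z\<in>p. \<epsilon> * (Sup (snd z) - Inf (snd z)))"
    proof (rule sum_mono2)
      fix z assume z: "z \<in> p - ?p2"
      obtain t K' where zt: "z = (t, K')" by force
      then have "Inf K' \<le> Sup K'" using K[of t K'] z by auto
      then show "0 \<le> \<epsilon> * (Sup (snd z) - Inf (snd z))" using \<epsilon> by (simp add: zt)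
    qed (use fin in auto)
    also have "\<dots> = \<epsilon> * (b - a)"
      using additive_tagged_division_1[OF ab p, of "\<lambda>x. x"]
      by (simp add: sum_distrib_left[symmetric] case_prod_beta)
    finally have s2: "\<bar>sum d ?p2\<bar> \<le> \<epsilon> * (b - a)" .
    have s1: "\<bar>sum d ?p1\<bar> \<le> \<epsilon>"
    proof -
      have finp1: "finite ?p1" using fin by simp
      \<comment> \<open>Absolute continuity is stated for indexed families, so the exceptional part
        of the division is enumerated.\<close>
      obtain e where e: "bij_betw e {0..<card ?p1} ?p1"
        using ex_bij_betw_nat_finite[OF finp1] by blast
      define n where "n = card ?p1"
      define x where "x i = Inf (snd (e i))" for i
      define y where "y i = Sup (snd (e i))" for i
      have ein: "e i \<in> p \<and> fst (e i) \<in> N" if "i < n" for i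
        using bij_betwE[OF e] that by (auto simp: n_def)
      have xy: "a \<le> x i \<and> x i \<le> y i \<and> y i \<le> b \<and> {x i..y i} = snd (e i) \<and> snd (e i) \<subseteq> U" if "i < n" for i
        using K[of "fst (e i)" "snd (e i)"] ein[OF that] by (auto simp: x_def y_def \<gamma>_def)
      have disj: "disjoint_family_on (\<lambda>i. {x i<..<y i}) {..<n}"
        unfolding disjoint_family_on_def
      proof (intro ballI impI)
        fix i j assume ij: "i \<in> {..<n}" "j \<in> {..<n}" "i \<noteq> j"
        then have ne: "e i \<noteq> e j"
          using bij_betw_imp_inj_on[OF e] by (auto simp: inj_on_def n_def)
        have "interior (snd (e i)) \<inter> interior (snd (e j)) = {}"
          using tagged_division_ofD(5)[OF p, of "fst (e i)" "snd (e i)" "fst (e j)" "snd (e j)"]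
            ein ij ne by auto
        then show "{x i<..<y i} \<inter> {x j<..<y j} = {}"
          using xy[of i] xy[of j] ij interior_atLeastAtMost_real by (metis lessThan_iff)
      qed
      have "ennreal (\<Sum>i<n. y i - x i) = (\<Sum>i<n. emeasure lebesgue {x i<..<y i})"
        using xy by (subst sum_ennreal[symmetric]) (auto intro!: sum.cong)
      also have "\<dots> = emeasure lebesgue (\<Union>i<n. {x i<..<y i})"
        using disj by (intro sum_emeasure) auto
      also have "\<dots> \<le> emeasure lebesgue U"
      proof (rule emeasure_mono)
        have "{x i<..<y i} \<subseteq> U" if "i < n" for i
          using xy[OF that] greaterThanLessThan_subseteq_atLeastAtMost_iff[of "x i" "y i" "x i" "y i"] by blast
        then show "(\<Union>i<n. {x i<..<y i}) \<subseteq> U" by blast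
        show "U \<in> sets lebesgue" using U(1) by auto
      qed
      also have "\<dots> < ennreal \<eta>" by fact
      finally have "(\<Sum>i<n. y i - x i) < \<eta>"
        using xy by (subst (asm) ennreal_less_iff) (force intro: sum_nonneg)+
      then have "(\<Sum>i<n. \<bar>h (y i) - h (x i)\<bar>) < \<epsilon>"
        using AC[of n x y] xy disj by blast
      moreover have "sum d ?p1 = (\<Sum>i<n. d (e i))"
        using sum.reindex_bij_betw[OF e, of d] by (simp add: n_def atLeast0LessThan)
      moreover have "\<dots> = (\<Sum>i<n. h (y i) - h (x i))"
        by (simp add: d_def x_def y_def case_prod_beta)
      ultimately show ?thesis using sum_abs[of "\<lambda>i. h (y i) - h (x i)" "{..<n}"] by linarith
    qed
    show ?thesis using split s1 s2 by linarith
  qed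
  have "\<bar>h b - h a\<bar> \<le> 0"
  proof (rule field_le_epsilon)
    fix e :: real assume e: "e > 0"
    have "\<bar>h b - h a\<bar> \<le> e / (b - a + 1) * (b - a) + e / (b - a + 1)"
      using small[of "e / (b - a + 1)"] e ab by simp
    also have "\<dots> = e / (b - a + 1) * (b - a + 1)" by (simp add: distrib_left)
    also have "\<dots> = e" using ab by simp
    finally show "\<bar>h b - h a\<bar> \<le> 0 + e" by simp
  qed
  then show ?thesis by simp
qed

text \<open>Turns an equation valid almost everywhere into an integrated one. As \<open>r\<close> is
  bounded on the compact interval, \<open>R\<close> is Lipschitz, so \<open>h - R\<close> is
  absolutely continuous with derivative zero almost everywhere.\<close>

lemma abs_continuous_on_interval_antiderivative:
  assumes ab: "a \<le> b" and ac: "abs_continuous_on_interval a b h"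
    and R: "\<And>t. t \<in> {a..b} \<Longrightarrow> (R has_real_derivative r t) (at t)"
    and r: "continuous_on {a..b} r"
    and ae: "AE t in lebesgue. t \<in> {a<..<b} \<longrightarrow> (h has_real_derivative r t) (at t)"
  shows "h b - R b = h a - R a"
proof (rule abs_continuous_on_interval_deriv_zero_imp_eq[OF ab])
  obtain B where B: "\<And>t. t \<in> {a..b} \<Longrightarrow> \<bar>r t\<bar> \<le> B" "B \<ge> 0"
  proof -
    have "bounded (r ` {a..b})"
      using r compact_continuous_image compact_imp_bounded compact_Icc by blast
    then obtain B where "\<And>t. t \<in> {a..b} \<Longrightarrow> norm (r t) \<le> B" unfolding bounded_iff by blast
    then show ?thesis using that[of "max B 0"] by (simp add: le_max_iff_disj)
  qed
  have "B-lipschitz_on {a..b} R"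
  proof (rule bounded_derivative_imp_lipschitz)
    show "(R has_derivative (*) (r t)) (at t within {a..b})" if "t \<in> {a..b}" for t
      using DERIV_subset[OF R[OF that], of "{a..b}"] by (simp add: has_field_derivative_def)
    show "onorm ((*) (r t)) \<le> B" if "t \<in> {a..b}" for t
      using B(1)[OF that] by (intro onorm_le) (simp add: abs_mult mult_right_mono)
  qed (use B in auto)
  then show "abs_continuous_on_interval a b (\<lambda>t. h t - R t)"
    by (intro abs_continuous_on_interval_diff ac lipschitz_imp_abs_continuous_on_interval)
  show "AE t in lebesgue. t \<in> {a<..<b} \<longrightarrow> ((\<lambda>t. h t - R t) has_real_derivative 0) (at t)"
    using ae
  proof eventually_elim
    case (elim t)
    show ?case
    proof
      assume t: "t \<in> {a<..<b}"
      then have "(R has_real_derivative r t) (at t)" by (intro R) auto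
      then show "((\<lambda>t. h t - R t) has_real_derivative 0) (at t)"
        using DERIV_diff[OF elim[rule_format, OF t], of R "r t"] by simp
    qed
  qed
qed

section \<open>A Picard theorem on the half-line\<close>

text \<open>With \<open>M = L + 1 > 0\<close>, the Picard operator contracts by the factor \<open>1/2\<close> in the supremum norm
  weighted by \<open>exp (-2 M t)\<close>, so no continuation argument is needed.\<close>

lemma lipschitz_ode_exists_ray:
  fixes X :: "'a::euclidean_space \<Rightarrow> 'a"
  assumes "L-lipschitz_on UNIV X"
  shows "\<exists>y. y 0 = y0 \<and> (\<forall>t\<ge>0. (y has_vector_derivative X (y t)) (at t within {0..}))"
proof -
  define M where "M = L + 1"
  have M: "M-lipschitz_on UNIV X" "M > 0"
    using assms lipschitz_on_nonneg[OF assms] by (auto simp: M_def intro: lipschitz_on_le)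
  have contX: "continuous_on S X" for S
    using lipschitz_on_continuous_on[OF M(1)] continuous_on_subset by blast
  have XM: "norm (X a - X b) \<le> M * norm (a - b)" for a b
    using lipschitz_on_normD[OF M(1)] by simp
  \<comment> \<open>The contraction factor originates here: with twice the Lipschitz constant in the
    exponent, integrating \<open>M * exp (2 * M * s)\<close> leaves half of the weight.\<close>
  have expint: "((\<lambda>s. M * exp (2 * M * s)) has_integral (exp (2 * M * m) - 1) / 2) {0..m}"
    if "m \<ge> 0" for m
  proof -
    have "((\<lambda>s. M * exp (2 * M * s)) has_integral exp (2 * M * m) / 2 - exp (2 * M * 0) / 2) {0..m}"
      by (rule fundamental_theorem_of_calculus[OF that])
        (auto intro!: derivative_eq_intros simp: has_real_derivative_iff_has_vector_derivative[symmetric])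
    then show ?thesis by (simp add: diff_divide_distrib)
  qed
  \<comment> \<open>\<open>Y\<close> removes the weight from \<open>u\<close>, and \<open>A\<close>
    is the Picard operator in the weighted variable. Bounded continuous functions live on the whole
    line here, so \<open>max 0 t\<close> continues the image constantly to negative times.\<close>
  define Y where "Y u s = exp (2 * M * s) *\<^sub>R apply_bcontfun u s" for u :: "real \<Rightarrow>\<^sub>C 'a" and s
  define A where "A u t = exp (- (2 * M * max 0 t)) *\<^sub>R (y0 + integral {0..max 0 t} (\<lambda>s. X (Y u s)))" for u t
  have contXY: "continuous_on S (\<lambda>s. X (Y u s))" for S u
    unfolding Y_def by (intro continuous_on_compose2[OF contX[of UNIV]] continuous_intros) auto
  have intXY: "(\<lambda>s. X (Y u s)) integrable_on {0..m}" for u m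
    by (intro integrable_continuous_real contXY)
  have dist_le: "norm (integral {0..m} (\<lambda>s. X (Y u s) - X (Y v s))) \<le> (exp (2 * M * m) - 1) / 2 * dist u v"
    if "m \<ge> 0" for u v m
  proof -
    have "norm (integral {0..m} (\<lambda>s. X (Y u s) - X (Y v s))) \<le>
        integral {0..m} (\<lambda>s. M * exp (2 * M * s) * dist u v)"
    proof (rule integral_norm_bound_integral)
      show "(\<lambda>s. X (Y u s) - X (Y v s)) integrable_on {0..m}" by (intro integrable_diff intXY)
      show "(\<lambda>s. M * exp (2 * M * s) * dist u v) integrable_on {0..m}"
        by (intro integrable_continuous_real continuous_intros)
      fix s
      have "norm (Y u s - Y v s) = exp (2 * M * s) * dist (apply_bcontfun u s) (apply_bcontfun v s)"
        by (simp add: Y_def dist_norm flip: scaleR_diff_right)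
      also have "\<dots> \<le> exp (2 * M * s) * dist u v" by (simp add: dist_bounded)
      finally show "norm (X (Y u s) - X (Y v s)) \<le> M * exp (2 * M * s) * dist u v"
        using XM[of "Y u s" "Y v s"] M(2) by (smt (verit) mult.assoc mult_left_mono)
    qed
    also have "\<dots> = (exp (2 * M * m) - 1) / 2 * dist u v"
      by (intro integral_unique has_integral_mult_left expint that)
    finally show ?thesis .
  qed
  have contI: "continuous_on UNIV (\<lambda>t. integral {0..max 0 t} (\<lambda>s. X (Y u s)))" for u
  proof -
    have "continuous_on {0..} (\<lambda>t. integral {0..t} (\<lambda>s. X (Y u s)))"
      unfolding continuous_on_eq_continuous_within
    proof
      fix x :: real assume "x \<in> {0..}"
      have "continuous_on {0..x+1} (\<lambda>t. integral {0..t} (\<lambda>s. X (Y u s)))"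
        by (rule indefinite_integral_continuous_1[OF intXY])
      then have "continuous (at x within {0..x+1}) (\<lambda>t. integral {0..t} (\<lambda>s. X (Y u s)))"
        using \<open>x \<in> {0..}\<close> by (simp add: continuous_on_eq_continuous_within)
      moreover have "at x within {0..x+1} = at x within {0..}"
        by (rule at_within_nhd[of _ "{..<x+1}"]) auto
      ultimately show "continuous (at x within {0..}) (\<lambda>t. integral {0..t} (\<lambda>s. X (Y u s)))" by simp
    qed
    then show ?thesis
      by (rule continuous_on_compose2) (auto intro!: continuous_intros)
  qed
  have Y0: "Y 0 s = 0" for s by (simp add: Y_def)
  \<comment> \<open>Growth is measured from the zero function. What remains is the linearly growing
    term \<open>m * norm (X 0)\<close>, which the exponential weight absorbs.\<close>
  have bnd: "norm (A u t) \<le> norm y0 + norm (X 0) / M + norm u" for u t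
  proof -
    define m where "m = max 0 t"
    have m: "m \<ge> 0" by (simp add: m_def)
    have "integral {0..m} (\<lambda>s. X (Y u s)) = integral {0..m} (\<lambda>s. X (Y u s) - X (Y 0 s)) + m *\<^sub>R X 0"
      using integral_diff[OF intXY[of u m] intXY[of 0 m]] m by (simp add: Y0)
    then have "norm (integral {0..m} (\<lambda>s. X (Y u s))) \<le> (exp (2 * M * m) - 1) / 2 * norm u + m * norm (X 0)"
      using dist_le[OF m, of u 0] m norm_triangle_ineq[of "integral {0..m} (\<lambda>s. X (Y u s) - X (Y 0 s))" "m *\<^sub>R X 0"]
      by simp
    also have "\<dots> \<le> exp (2 * M * m) * norm u + exp (2 * M * m) * (norm (X 0) / M)"
    proof (intro add_mono)
      show "(exp (2 * M * m) - 1) / 2 * norm u \<le> exp (2 * M * m) * norm u"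
        using m M(2) by (intro mult_right_mono) (auto simp: field_simps intro: order_trans[of _ 0])
      have "M * m \<le> 2 * M * m" using M(2) m by simp
      also have "2 * M * m \<le> exp (2 * M * m)" using exp_ge_add_one_self[of "2 * M * m"] by linarith
      finally have "m \<le> exp (2 * M * m) / M" using M(2) by (simp add: field_simps)
      then show "m * norm (X 0) \<le> exp (2 * M * m) * (norm (X 0) / M)"
        using mult_right_mono[of m "exp (2 * M * m) / M" "norm (X 0)"] by simp
    qed
    finally have I: "norm (integral {0..m} (\<lambda>s. X (Y u s))) \<le> exp (2 * M * m) * (norm (X 0) / M + norm u)"
      by (simp add: algebra_simps)
    have "norm (A u t) \<le> exp (- (2 * M * m)) * (norm y0 + norm (integral {0..m} (\<lambda>s. X (Y u s))))"
      by (simp add: A_def m_def[symmetric] norm_triangle_ineq)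
    also have "\<dots> \<le> exp (- (2 * M * m)) * norm y0 + exp (- (2 * M * m)) * (exp (2 * M * m) * (norm (X 0) / M + norm u))"
      using mult_left_mono[OF I, of "exp (- (2 * M * m))"] by (simp add: distrib_left del: exp_minus)
    also have "exp (- (2 * M * m)) * (exp (2 * M * m) * (norm (X 0) / M + norm u)) = norm (X 0) / M + norm u"
      by (simp add: exp_minus)
    also have "exp (- (2 * M * m)) * norm y0 \<le> 1 * norm y0"
      using M(2) m by (intro mult_right_mono) auto
    finally show ?thesis by simp
  qed
  have contA: "continuous_on UNIV (A u)" for u
    unfolding A_def by (intro continuous_intros contI)
  have Ab: "A u \<in> bcontfun" for u
    using contA bnd by (rule bcontfun_normI)
  define P where "P u = Bcontfun (A u)" for u
  have P: "apply_bcontfun (P u) = A u" for u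
    unfolding P_def using Ab by (rule Bcontfun_inverse)
  have "\<exists>!u. P u = u"
  proof (rule banach_fix_type[of "1/2"])
    show "\<forall>u v. dist (P u) (P v) \<le> 1/2 * dist u v"
    proof (intro allI dist_bound)
      fix u v :: "real \<Rightarrow>\<^sub>C 'a" and t :: real
      define m where "m = max 0 t"
      have m: "m \<ge> 0" unfolding m_def by (rule max.cobounded1)
      have "A u t - A v t = exp (- (2 * M * m)) *\<^sub>R integral {0..m} (\<lambda>s. X (Y u s) - X (Y v s))"
        unfolding A_def m_def[symmetric] integral_diff[OF intXY intXY] by (simp add: algebra_simps)
      then have "dist (A u t) (A v t) = exp (- (2 * M * m)) * norm (integral {0..m} (\<lambda>s. X (Y u s) - X (Y v s)))"
        by (simp add: dist_norm)
      also have "\<dots> \<le> exp (- (2 * M * m)) * ((exp (2 * M * m) - 1) / 2 * dist u v)"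
        by (intro mult_left_mono dist_le m) auto
      also have "\<dots> = (1 - exp (- (2 * M * m))) / 2 * dist u v"
        by (simp add: exp_minus field_simps)
      also have "\<dots> \<le> 1/2 * dist u v" by (intro mult_right_mono) auto
      finally show "dist (apply_bcontfun (P u) t) (apply_bcontfun (P v) t) \<le> 1/2 * dist u v" by (simp add: P)
    qed
  qed auto
  then obtain u where "P u = u" by blast
  then have u: "apply_bcontfun u t = A u t" for t using P by metis
  define y where "y t = Y u t" for t
  have y: "y t = y0 + integral {0..t} (\<lambda>s. X (y s))" if "t \<ge> 0" for t
    using that unfolding y_def by (subst Y_def) (simp add: u A_def exp_minus)
  have "(y has_vector_derivative X (y t)) (at t within {0..})" if t: "t \<ge> 0" for t
  proof -
    have "((\<lambda>t. y0 + integral {0..t} (\<lambda>s. X (y s))) has_vector_derivative 0 + X (y t)) (at t within {0..t+1})"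
      using t contXY unfolding y_def
      by (intro has_vector_derivative_add has_vector_derivative_const integral_has_vector_derivative) auto
    then have "((\<lambda>t. y0 + integral {0..t} (\<lambda>s. X (y s))) has_vector_derivative X (y t)) (at t within {0..t+1})"
      by simp
    then have "(y has_vector_derivative X (y t)) (at t within {0..t+1})"
      by (rule has_vector_derivative_transform[rotated 2]) (use y t in auto)
    moreover have "at t within {0..t+1} = at t within {0..}"
      by (rule at_within_nhd[of _ "{..<t+1}"]) auto
    ultimately show ?thesis by simp
  qed
  moreover have "y 0 = y0" using y[of 0] by simp
  ultimately show ?thesis by blast
qed

section \<open>The first-order system\<close>

text \<open>The relation between velocity and momentum of a relativistic particle of unit mass, with
  speed of light 1; \<open>momentum\<close> below is its inverse on ]-1,1[.\<close>

definition velocity :: "real \<Rightarrow> real" where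
  "velocity w = w / sqrt (1 + w\<^sup>2)"

definition momentum :: "real \<Rightarrow> real" where
  "momentum p = p / sqrt (1 - p\<^sup>2)"

lemma sqrt_one_plus_square_gt [simp]: "\<bar>w\<bar> < sqrt (1 + w\<^sup>2)" for w :: real
  by (rule real_less_rsqrt) simp

lemma one_plus_square_pos [simp]: "0 < 1 + w\<^sup>2" "1 + w\<^sup>2 \<noteq> 0" "\<not> 1 + w\<^sup>2 < 0" for w :: real
  by (smt (verit) zero_le_power2)+

lemma velocity_less_one: "\<bar>velocity w\<bar> < 1"
  unfolding velocity_def abs_divide
  using sqrt_one_plus_square_gt[of w] by (simp add: divide_less_eq)

lemma velocity_simps [simp]:
  "velocity 0 = 0" "velocity (- w) = - velocity w"
  "velocity w = 0 \<longleftrightarrow> w = 0" "0 < velocity w \<longleftrightarrow> 0 < w" "velocity w < 0 \<longleftrightarrow> w < 0"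
  by (auto simp: velocity_def zero_less_divide_iff divide_less_0_iff)

lemma velocity_momentum:
  assumes "\<bar>p\<bar> < 1" shows "velocity (momentum p) = p"
proof -
  have p: "p\<^sup>2 < 1" using assms by (simp add: abs_square_less_1)
  have "1 + (momentum p)\<^sup>2 = 1 / (1 - p\<^sup>2)"
    using p by (simp add: momentum_def power_divide field_simps)
  then have "sqrt (1 + (momentum p)\<^sup>2) = 1 / sqrt (1 - p\<^sup>2)" by (simp add: real_sqrt_divide)
  then show ?thesis using p by (simp add: velocity_def momentum_def)
qed

lemma momentum_velocity: "momentum (velocity w) = w"
proof -
  have "1 - (velocity w)\<^sup>2 = 1 / (1 + w\<^sup>2)"
    by (simp add: velocity_def power_divide field_simps)
  then have "sqrt (1 - (velocity w)\<^sup>2) = 1 / sqrt (1 + w\<^sup>2)" by (simp add: real_sqrt_divide)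
  then show ?thesis by (simp add: velocity_def momentum_def)
qed

lemma sqrt_one_plus_square_deriv:
  "((\<lambda>w. sqrt (1 + w\<^sup>2)) has_real_derivative velocity w) (at w)"
  by (auto intro!: derivative_eq_intros simp: velocity_def divide_simps)

lemma velocity_deriv:
  "(velocity has_real_derivative 1 / sqrt (1 + w\<^sup>2) ^ 3) (at w)"
proof -
  have "(velocity has_real_derivative (sqrt (1 + w\<^sup>2) - w * velocity w) / (sqrt (1 + w\<^sup>2) * sqrt (1 + w\<^sup>2))) (at w)"
    unfolding velocity_def[abs_def]
    by (rule derivative_eq_intros DERIV_ident sqrt_one_plus_square_deriv[unfolded velocity_def] refl)+ auto
  moreover have "(sqrt (1 + w\<^sup>2) - w * velocity w) / (sqrt (1 + w\<^sup>2) * sqrt (1 + w\<^sup>2)) = 1 / sqrt (1 + w\<^sup>2) ^ 3"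
    by (simp add: velocity_def divide_simps power3_eq_cube power2_eq_square[symmetric])
  ultimately show ?thesis by simp
qed

lemma momentum_deriv:
  assumes "\<bar>p\<bar> < 1"
  shows "(momentum has_real_derivative 1 / sqrt (1 - p\<^sup>2) ^ 3) (at p)"
proof -
  have p: "p\<^sup>2 < 1" using assms by (simp add: abs_square_less_1)
  have "(momentum has_real_derivative (sqrt (1 - p\<^sup>2) - p * (- p / sqrt (1 - p\<^sup>2))) / (sqrt (1 - p\<^sup>2) * sqrt (1 - p\<^sup>2))) (at p)"
    unfolding momentum_def[abs_def] using p
    by (auto intro!: derivative_eq_intros simp: field_simps)
  moreover have "(sqrt (1 - p\<^sup>2) - p * (- p / sqrt (1 - p\<^sup>2))) / (sqrt (1 - p\<^sup>2) * sqrt (1 - p\<^sup>2)) = 1 / sqrt (1 - p\<^sup>2) ^ 3"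
    using p by (simp add: divide_simps power3_eq_cube power2_eq_square[symmetric])
  ultimately show ?thesis by simp
qed

text \<open>The gain of working with the momentum: the equation is singular at |v'| = 1, whereas in
  the variables (v, w) the vector field becomes globally Lipschitz.\<close>

lemma velocity_lipschitz: "1-lipschitz_on UNIV velocity"
proof (rule bounded_derivative_imp_lipschitz)
  show "(velocity has_derivative (*) (1 / sqrt (1 + w\<^sup>2) ^ 3)) (at w within UNIV)" for w
    using velocity_deriv[of w] by (simp add: has_field_derivative_def)
  show "onorm ((*) (1 / sqrt (1 + w\<^sup>2) ^ 3)) \<le> 1" for w
  proof (rule onorm_le)
    fix x :: real
    have "1 \<le> sqrt (1 + w\<^sup>2) ^ 3" by (intro one_le_power) simp
    then have "\<bar>1 / sqrt (1 + w\<^sup>2) ^ 3\<bar> \<le> 1" by (simp add: divide_le_eq_1)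
    then show "norm (1 / sqrt (1 + w\<^sup>2) ^ 3 * x) \<le> 1 * norm x"
      using mult_right_mono[of "\<bar>1 / sqrt (1 + w\<^sup>2) ^ 3\<bar>" 1 "\<bar>x\<bar>"] by (simp add: abs_mult)
  qed
qed auto

lemma continuous_on_velocity [continuous_intros]:
  "continuous_on S h \<Longrightarrow> continuous_on S (\<lambda>t. velocity (h t))"
  using lipschitz_on_continuous_on[OF velocity_lipschitz] continuous_on_compose2 by blast

lemma tendsto_velocity [tendsto_intros]:
  "(h \<longlongrightarrow> l) A \<Longrightarrow> ((\<lambda>t. velocity (h t)) \<longlongrightarrow> velocity l) A"
  using isCont_tendsto_compose[OF DERIV_isCont[OF velocity_deriv]] by blast

lemma ray_at_within: "t > 0 \<Longrightarrow> at t within {0..} = at t" for t :: real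
  by (intro at_within_interior) (simp add: interior_real_atLeast)

section \<open>Monotonicity and limits on a half-line from the derivative\<close>

lemma ray_nonneg_deriv_imp_mono:
  assumes h: "\<And>t. t \<ge> 0 \<Longrightarrow> (h has_real_derivative h' t) (at t within {0..})"
    and ab: "0 \<le> a" "a \<le> b" and pos: "\<And>t. a < t \<Longrightarrow> t < b \<Longrightarrow> 0 \<le> h' t"
  shows "h a \<le> h b"
proof (rule DERIV_nonneg_imp_increasing_open[OF ab(2)])
  show "\<exists>y. (h has_real_derivative y) (at x) \<and> y \<ge> 0" if "a < x" "x < b" for x
    using h[of x] that ab pos ray_at_within[of x] by force
  have "continuous_on {0..} h" using h by (intro DERIV_continuous_on) auto
  then show "continuous_on {a..b} h" using ab by (auto intro: continuous_on_subset)
qed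

lemma ray_pos_deriv_imp_less:
  assumes h: "\<And>t. t \<ge> 0 \<Longrightarrow> (h has_real_derivative h' t) (at t within {0..})"
    and ab: "0 \<le> a" "a < b" and pos: "\<And>t. a < t \<Longrightarrow> t < b \<Longrightarrow> 0 < h' t"
  shows "h a < (h b :: real)"
proof (rule DERIV_pos_imp_increasing_open[OF ab(2)])
  show "\<exists>y. (h has_real_derivative y) (at x) \<and> y > 0" if "a < x" "x < b" for x
    using h[of x] that ab pos ray_at_within[of x] by force
  have "continuous_on {0..} h" using h by (intro DERIV_continuous_on) auto
  then show "continuous_on {a..b} h" using ab by (auto intro: continuous_on_subset)
qed

lemma ray_bounded_deriv_limit_nonpos:
  assumes h: "\<And>t. t \<ge> 0 \<Longrightarrow> (h has_real_derivative h' t) (at t within {0..})"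
    and lim: "(h' \<longlongrightarrow> c) at_top" and bd: "\<And>t. t \<ge> 0 \<Longrightarrow> h t \<le> B"
  shows "c \<le> 0"
proof (rule ccontr)
  assume "\<not> c \<le> 0" then have c: "c > 0" by simp
  then have "eventually (\<lambda>t. h' t > c / 2) at_top"
    using lim by (intro order_tendstoD(1)) auto
  then obtain T0 where T0: "\<And>t. t \<ge> T0 \<Longrightarrow> h' t > c / 2"
    by (auto simp: eventually_at_top_linorder)
  define T where "T = max 0 T0"
  have T: "T \<ge> 0" "\<And>t. t \<ge> T \<Longrightarrow> h' t > c / 2" using T0 by (auto simp: T_def)
  \<comment> \<open>By this time the lower bound of slope \<open>c / 2\<close> has risen by
    \<open>\<bar>B - h T\<bar> + 1\<close> above \<open>h T\<close>, hence past
    \<open>B\<close>.\<close>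
  define b where "b = T + 2 * (\<bar>B - h T\<bar> + 1) / c"
  have b: "b \<ge> T" using c by (simp add: b_def)
  have "h T - c / 2 * T \<le> h b - c / 2 * b"
  proof (rule ray_nonneg_deriv_imp_mono[where h' = "\<lambda>t. h' t - c / 2", OF _ T(1) b])
    show "((\<lambda>t. h t - c / 2 * t) has_real_derivative h' t - c / 2) (at t within {0..})" if "t \<ge> 0" for t
      using h[OF that] by (auto intro!: derivative_eq_intros)
    show "0 \<le> h' t - c / 2" if "T < t" for t using T(2)[of t] that by auto
  qed
  moreover have "c / 2 * b = c / 2 * T + (\<bar>B - h T\<bar> + 1)"
    using c by (simp add: b_def field_simps)
  moreover have "h b \<le> B" using bd b T(1) by simp
  ultimately show False by linarith
qed

lemma ray_bounded_deriv_limit_zero: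
  assumes h: "\<And>t. t \<ge> 0 \<Longrightarrow> (h has_real_derivative h' t) (at t within {0..})"
    and lim: "(h' \<longlongrightarrow> c) at_top" and bd: "\<And>t. t \<ge> 0 \<Longrightarrow> \<bar>h t\<bar> \<le> B"
  shows "c = 0"
proof -
  have "c \<le> 0"
    using ray_bounded_deriv_limit_nonpos[OF h lim, of B] bd by (meson abs_le_D1)
  moreover have "- c \<le> 0"
    using ray_bounded_deriv_limit_nonpos[of "\<lambda>t. - h t" "\<lambda>t. - h' t" "- c" B] h bd lim
    by (auto intro: DERIV_minus tendsto_minus simp: abs_le_iff)
  ultimately show ?thesis by simp
qed

text \<open>The time reversal of an orbit is \<open>(x (- t), - w (- t))\<close>, an orbit of the same system; this is
  why orbits on half-lines \<open>[0, \<infinity>[\<close> suffice.\<close>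

definition half_orbit :: "(real \<Rightarrow> real) \<Rightarrow> real \<Rightarrow> (real \<Rightarrow> real) \<Rightarrow> (real \<Rightarrow> real) \<Rightarrow> bool" where
  "half_orbit g k x w \<longleftrightarrow> (\<forall>t\<ge>0.
    (x has_real_derivative velocity (w t)) (at t within {0..}) \<and>
    (w has_real_derivative - k * g (x t)) (at t within {0..}))"

lemma half_orbitD:
  assumes "half_orbit g k x w" "t \<ge> 0"
  shows "(x has_real_derivative velocity (w t)) (at t within {0..})"
    and "(w has_real_derivative - k * g (x t)) (at t within {0..})"
  using assms by (auto simp: half_orbit_def)

lemma half_orbit_continuous:
  assumes "half_orbit g k x w"
  shows "continuous_on {0..} x" "continuous_on {0..} w"
  using half_orbitD[OF assms] by (intro DERIV_continuous_on; force)+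

lemma half_orbit_shift:
  assumes "half_orbit g k x w" "s \<ge> 0"
  shows "half_orbit g k (\<lambda>t. x (t + s)) (\<lambda>t. w (t + s))"
  unfolding half_orbit_def
proof (intro allI impI)
  have *: "((\<lambda>t. h (t + s)) has_real_derivative D) (at t within {0..})"
    if "(h has_real_derivative D) (at (t + s) within {0..})" for h :: "real \<Rightarrow> real" and t D
  proof -
    have "(h has_real_derivative D) (at (t + s) within (\<lambda>t. t + s) ` {0..})"
      using that by (rule DERIV_subset) (use assms(2) in auto)
    moreover have "((\<lambda>t. t + s) has_real_derivative 1) (at t within {0..})"
      by (auto intro!: derivative_eq_intros)
    ultimately show ?thesis using DERIV_image_chain[of h D "\<lambda>t. t + s" t "{0..}" 1] by (simp add: o_def)
  qed
  fix t :: real assume "t \<ge> 0"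
  then show "((\<lambda>t. x (t + s)) has_real_derivative velocity (w (t + s))) (at t within {0..}) \<and>
    ((\<lambda>t. w (t + s)) has_real_derivative - k * g (x (t + s))) (at t within {0..})"
    using half_orbitD[OF assms(1), of "t + s"] assms(2) by (auto intro!: *)
qed

lemma half_orbit_exists:
  assumes "L-lipschitz_on UNIV g"
  shows "\<exists>x w. half_orbit g k x w \<and> x 0 = x0 \<and> w 0 = w0"
proof -
  define X where "X = (\<lambda>(x, w). (velocity w, - k * g x))"
  have "(1 + \<bar>k\<bar> * L)-lipschitz_on UNIV X"
  proof (rule lipschitz_onI)
    fix a b :: "real \<times> real"
    obtain x1 w1 x2 w2 where ab: "a = (x1, w1)" "b = (x2, w2)" by force
    have "dist (X a) (X b) \<le> \<bar>velocity w1 - velocity w2\<bar> + \<bar>k * g x1 - k * g x2\<bar>"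
      using sqrt_sum_squares_le_sum_abs[of "velocity w1 - velocity w2" "k * g x1 - k * g x2"]
      by (simp add: X_def ab dist_Pair_Pair dist_real_def power2_commute)
    also have "\<dots> \<le> \<bar>w1 - w2\<bar> + \<bar>k\<bar> * (L * \<bar>x1 - x2\<bar>)"
      using lipschitz_onD[OF velocity_lipschitz, of w1 w2] lipschitz_onD[OF assms, of x1 x2]
      by (intro add_mono) (auto simp: dist_real_def abs_mult mult_left_mono simp flip: right_diff_distrib)
    also have "\<dots> \<le> dist a b + \<bar>k\<bar> * (L * dist a b)"
      using dist_fst_le[of a b] dist_snd_le[of a b] lipschitz_on_nonneg[OF assms]
      by (intro add_mono mult_left_mono) (auto simp: ab dist_real_def)
    finally show "dist (X a) (X b) \<le> (1 + \<bar>k\<bar> * L) * dist a b" by (simp add: algebra_simps)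
  qed (use lipschitz_on_nonneg[OF assms] in auto)
  from lipschitz_ode_exists_ray[OF this, of "(x0, w0)"] obtain y where
    y: "y 0 = (x0, w0)" "\<And>t. t \<ge> 0 \<Longrightarrow> (y has_vector_derivative X (y t)) (at t within {0..})"
    by blast
  have "half_orbit g k (\<lambda>t. fst (y t)) (\<lambda>t. snd (y t))"
    unfolding half_orbit_def
  proof (intro allI impI conjI)
    fix t :: real assume t: "t \<ge> 0"
    have Xy: "fst (X (y t)) = velocity (snd (y t))" "snd (X (y t)) = - k * g (fst (y t))"
      by (simp_all add: X_def case_prod_beta)
    show "((\<lambda>t. fst (y t)) has_real_derivative velocity (snd (y t))) (at t within {0..})"
      using bounded_linear.has_vector_derivative[OF bounded_linear_fst y(2)[OF t]]
      by (simp add: has_real_derivative_iff_has_vector_derivative Xy)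
    show "((\<lambda>t. snd (y t)) has_real_derivative - k * g (fst (y t))) (at t within {0..})"
      using bounded_linear.has_vector_derivative[OF bounded_linear_snd y(2)[OF t]]
      by (simp add: has_real_derivative_iff_has_vector_derivative Xy)
  qed
  then show ?thesis using y(1) by (intro exI[of _ "\<lambda>t. fst (y t)"] exI[of _ "\<lambda>t. snd (y t)"]) simp
qed

text \<open>The squared distance \<open>D\<close> of two orbits satisfies \<open>\<bar>D'\<bar> \<le> C D\<close>, so \<open>D exp (- C t)\<close> decreases
  and \<open>D exp (C t)\<close> increases: the orbits coincide after and before any common point.\<close>

lemma half_orbit_unique:
  assumes lip: "L-lipschitz_on UNIV g"
    and o1: "half_orbit g k x w" and o2: "half_orbit g k y z"
    and s: "s \<ge> 0" "x s = y s" "w s = z s" and t: "t \<ge> 0"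
  shows "x t = y t \<and> w t = z t"
proof -
  define C where "C = 1 + \<bar>k\<bar> * L"
  define D where "D t = (x t - y t)\<^sup>2 + (w t - z t)\<^sup>2" for t
  define D' where "D' t = 2 * (x t - y t) * (velocity (w t) - velocity (z t)) +
    2 * (w t - z t) * (- k * g (x t) - - k * g (y t))" for t
  have derD: "(D has_real_derivative D' t) (at t within {0..})" if "t \<ge> 0" for t
    unfolding D_def[abs_def] D'_def
    using half_orbitD[OF o1 that] half_orbitD[OF o2 that]
    by (auto intro!: derivative_eq_intros simp: algebra_simps)
  have D': "\<bar>D' t\<bar> \<le> C * D t" for t
  proof -
    let ?a = "x t - y t" and ?b = "w t - z t"
    have "\<bar>velocity (w t) - velocity (z t)\<bar> \<le> \<bar>?b\<bar>"
      using lipschitz_onD[OF velocity_lipschitz, of "w t" "z t"] by (simp add: dist_real_def)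
    then have "\<bar>2 * ?a * (velocity (w t) - velocity (z t))\<bar> \<le> 2 * \<bar>?a\<bar> * \<bar>?b\<bar>"
      unfolding abs_mult by (simp add: mult_left_mono)
    moreover have "\<bar>g (x t) - g (y t)\<bar> \<le> L * \<bar>?a\<bar>"
      using lipschitz_onD[OF lip, of "x t" "y t"] by (simp add: dist_real_def)
    then have "\<bar>k\<bar> * \<bar>g (x t) - g (y t)\<bar> \<le> \<bar>k\<bar> * (L * \<bar>?a\<bar>)" by (simp add: mult_left_mono)
    then have "\<bar>- k * g (x t) - - k * g (y t)\<bar> \<le> \<bar>k\<bar> * (L * \<bar>?a\<bar>)"
      by (metis abs_mult abs_minus_cancel minus_diff_minus mult_minus_left right_diff_distrib)
    then have "\<bar>2 * ?b * (- k * g (x t) - - k * g (y t))\<bar> \<le> 2 * \<bar>?b\<bar> * (\<bar>k\<bar> * (L * \<bar>?a\<bar>))"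
      unfolding abs_mult[of "2 * ?b"] abs_mult[of 2] by (intro mult_mono) auto
    ultimately have "\<bar>D' t\<bar> \<le> 2 * \<bar>?a\<bar> * \<bar>?b\<bar> + 2 * \<bar>?b\<bar> * (\<bar>k\<bar> * (L * \<bar>?a\<bar>))"
      unfolding D'_def by (rule order_trans[OF abs_triangle_ineq add_mono])
    also have "\<dots> = C * (2 * \<bar>?a\<bar> * \<bar>?b\<bar>)" by (simp add: C_def algebra_simps)
    also have "\<dots> \<le> C * D t"
      using sum_squares_bound[of "\<bar>?a\<bar>" "\<bar>?b\<bar>"] lipschitz_on_nonneg[OF lip]
      by (intro mult_left_mono) (auto simp: D_def C_def)
    finally show ?thesis .
  qed
  have Ds: "D s = 0" using s by (simp add: D_def)
  have "D t \<le> 0"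
  proof (cases "s \<le> t")
    case True
    have "- (D s * exp (- C * s)) \<le> - (D t * exp (- C * t))"
    proof (rule ray_nonneg_deriv_imp_mono[where h' = "\<lambda>t. (C * D t - D' t) * exp (- C * t)", OF _ s(1) True])
      show "((\<lambda>t. - (D t * exp (- C * t))) has_real_derivative (C * D t - D' t) * exp (- C * t)) (at t within {0..})"
        if "t \<ge> 0" for t
        using derD[OF that] by (auto intro!: derivative_eq_intros simp: algebra_simps)
      show "0 \<le> (C * D t - D' t) * exp (- C * t)" for t using D'[of t] by (simp add: abs_le_iff)
    qed
    then show ?thesis using Ds by (simp add: mult_le_0_iff)
  next
    case False
    then have "t \<le> s" by simp
    have "D t * exp (C * t) \<le> D s * exp (C * s)"
    proof (rule ray_nonneg_deriv_imp_mono[where h' = "\<lambda>t. (C * D t + D' t) * exp (C * t)", OF _ t \<open>t \<le> s\<close>])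
      show "((\<lambda>t. D t * exp (C * t)) has_real_derivative (C * D t + D' t) * exp (C * t)) (at t within {0..})"
        if "t \<ge> 0" for t
        using derD[OF that] by (auto intro!: derivative_eq_intros simp: algebra_simps)
      show "0 \<le> (C * D t + D' t) * exp (C * t)" for t using D'[of t] by (simp add: abs_le_iff)
    qed
    then show ?thesis using Ds by (simp add: mult_le_0_iff)
  qed
  then show ?thesis by (simp add: D_def sum_power2_le_zero_iff)
qed

section \<open>Phase plane analysis\<close>

text \<open>Reduces a sign claim to the first zero, which exists by compactness of the zero set in
  [0,t]: before it \<open>h\<close> is negative, and \<open>step\<close> may exploit this.\<close>

lemma ray_first_zero:
  fixes h :: "real \<Rightarrow> real"
  assumes cont: "continuous_on {0..} h" and h0: "h 0 < 0"
    and step: "\<And>t. t > 0 \<Longrightarrow> (\<And>s. 0 \<le> s \<Longrightarrow> s < t \<Longrightarrow> h s < 0) \<Longrightarrow> h t \<noteq> 0"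
    and t: "t \<ge> 0"
  shows "h t < 0"
proof (rule ccontr)
  assume "\<not> h t < 0"
  have zero: "\<exists>u\<in>{0..s}. h u = 0" if "s \<ge> 0" "h s \<ge> 0" for s
  proof -
    have "continuous_on {0..s} h" using cont by (rule continuous_on_subset) auto
    then show ?thesis using IVT'[of h 0 0 s] h0 that by force
  qed
  define Z where "Z = {u \<in> {0..t}. h u = 0}"
  have "continuous_on {0..t} h" using cont by (rule continuous_on_subset) auto
  then have "closed Z" unfolding Z_def
    by (intro continuous_closed_preimage_constant) auto
  moreover have "bounded Z" by (rule bounded_subset[of "{0..t}"]) (auto simp: Z_def)
  ultimately have "compact Z" by (simp add: compact_eq_bounded_closed)
  moreover have "Z \<noteq> {}" using zero[OF t] \<open>\<not> h t < 0\<close> by (auto simp: Z_def)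
  ultimately obtain z where z: "z \<in> Z" "\<And>u. u \<in> Z \<Longrightarrow> z \<le> u"
    using compact_attains_inf by metis
  have "z > 0" using z(1) h0 by (cases "z = 0") (auto simp: Z_def)
  moreover have "h s < 0" if "0 \<le> s" "s < z" for s
  proof (rule ccontr)
    assume "\<not> h s < 0"
    then have "h s \<ge> 0" by simp
    then obtain u where "u \<in> {0..s}" "h u = 0" using zero[of s] \<open>0 \<le> s\<close> by auto
    then have "u \<in> Z" using z(1) that by (auto simp: Z_def)
    then show False using z(2) \<open>u \<in> {0..s}\<close> that by force
  qed
  ultimately have "h z \<noteq> 0" by (rule step)
  then show False using z(1) by (simp add: Z_def)
qed

text \<open>Every zero is crossed downwards. After one zero the function is negative, and a next
  zero would have to be approached from below, against the sign of the derivative there.\<close>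

lemma ray_transversal_zero_unique:
  assumes h: "\<And>t. t \<ge> 0 \<Longrightarrow> (h has_real_derivative h' t) (at t within {0..})"
    and neg: "\<And>t. t \<ge> 0 \<Longrightarrow> h t = 0 \<Longrightarrow> h' t < 0"
    and s: "s \<ge> 0" "h s = 0" and t: "s < t"
  shows "h t < 0"
proof -
  have cont: "continuous_on {0..} h" using h by (intro DERIV_continuous_on) auto
  obtain d where d: "d > 0" "\<And>e. e > 0 \<Longrightarrow> s + e \<in> {0..} \<Longrightarrow> e < d \<Longrightarrow> h (s + e) < h s"
    using has_real_derivative_neg_dec_right[OF h[OF s(1)] neg[OF s]] by auto
  \<comment> \<open>A moment at which \<open>h\<close> is already negative; the minimum keeps it at
    or before \<open>t\<close>.\<close>
  define r where "r = s + min (d / 2) (t - s)"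
  have r: "s < r" "r \<le> t" "h r < 0"
    using d(2)[of "min (d / 2) (t - s)"] d(1) t s by (auto simp: r_def min_def)
  have "h (r + (t - r)) < 0"
  proof (rule ray_first_zero[of "\<lambda>u. h (r + u)"])
    show "continuous_on {0..} (\<lambda>u. h (r + u))"
      by (rule continuous_on_compose2[OF cont]) (use r s in \<open>auto intro!: continuous_intros\<close>)
    show "h (r + u) \<noteq> 0" if u: "u > 0" "\<And>e. 0 \<le> e \<Longrightarrow> e < u \<Longrightarrow> h (r + e) < 0" for u
    proof
      assume z: "h (r + u) = 0"
      have "r + u \<ge> 0" using r s u by simp
      then obtain d where d: "d > 0" "\<And>e. e > 0 \<Longrightarrow> r + u - e \<in> {0..} \<Longrightarrow> e < d \<Longrightarrow> h (r + u) < h (r + u - e)"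
        using has_real_derivative_neg_dec_left[OF h neg[OF _ z]] by auto
      define e where "e = min (d / 2) u"
      have "0 < e" "e < d" "e \<le> u" using d(1) u(1) by (auto simp: e_def)
      then show False using d(2)[of e] u(2)[of "u - e"] z r s by (auto simp: algebra_simps)
    qed
  qed (use r in auto)
  then show ?thesis by simp
qed

lemma ray_mono_bounded_convergent:
  fixes h :: "real \<Rightarrow> real"
  assumes mono: "\<And>s t. 0 \<le> s \<Longrightarrow> s \<le> t \<Longrightarrow> h s \<le> h t" and bd: "\<And>t. t \<ge> 0 \<Longrightarrow> h t \<le> B"
  shows "\<exists>l. (h \<longlongrightarrow> l) at_top"
proof
  let ?l = "SUP t\<in>{0..}. h t"
  have bdd: "bdd_above (h ` {0..})" using bd by (intro bdd_aboveI2) auto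
  show "(h \<longlongrightarrow> ?l) at_top"
  proof (rule order_tendstoI)
    fix a assume "a < ?l"
    then obtain s where "s \<ge> 0" "a < h s" using less_cSUP_iff[OF _ bdd] by auto
    then show "eventually (\<lambda>t. a < h t) at_top"
      using mono by (auto intro!: eventually_at_top_linorderI[of s] intro: less_le_trans)
  next
    fix a assume "?l < a"
    then show "eventually (\<lambda>t. h t < a) at_top"
      using cSUP_upper[OF _ bdd] by (force intro!: eventually_at_top_linorderI[of 0] intro: le_less_trans)
  qed
qed

lemma ray_nonzero_sign:
  fixes h :: "real \<Rightarrow> real"
  assumes cont: "continuous_on {0..} h" and nz: "\<And>t. t \<ge> 0 \<Longrightarrow> h t \<noteq> 0"
  shows "(\<forall>t\<ge>0. h t > 0) \<or> (\<forall>t\<ge>0. h t < 0)"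
proof (cases "h 0 < 0")
  case True
  then show ?thesis using ray_first_zero[OF cont] nz by (metis less_imp_le)
next
  case False
  then have "- h 0 < 0" using nz[of 0] by simp
  moreover have "continuous_on {0..} (\<lambda>t. - h t)" using cont by (intro continuous_intros)
  ultimately have "- h t < 0" if "t \<ge> 0" for t
    using ray_first_zero[of "\<lambda>t. - h t" t] nz that by (metis less_imp_le neg_equal_0_iff_equal)
  then show ?thesis by simp
qed

lemma tendsto_at_top_shift:
  fixes h :: "real \<Rightarrow> 'a::topological_space"
  shows "((\<lambda>t. h (t + s)) \<longlongrightarrow> l) at_top \<longleftrightarrow> (h \<longlongrightarrow> l) at_top"
proof
  have lim: "filterlim (\<lambda>t. t + c) at_top at_top" for c :: real
    using filterlim_tendsto_add_at_top[OF tendsto_const filterlim_ident, of c] by (simp add: add.commute)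
  show "((\<lambda>t. h (t + s)) \<longlongrightarrow> l) at_top" if "(h \<longlongrightarrow> l) at_top"
    using filterlim_compose[OF that lim[of s]] .
  show "(h \<longlongrightarrow> l) at_top" if "((\<lambda>t. h (t + s)) \<longlongrightarrow> l) at_top"
    using filterlim_compose[OF that lim[of "- s"]] by simp
qed

text \<open>\<open>g\<close> stands for the extended nonlinearity and \<open>G\<close> for its
  potential. The second zero \<beta> of the potential is a parameter so that F(1) > 0 (where \<beta>
  < 1) and F(1) = 0 (where \<beta> = 1) can be treated together.\<close>

locale bistable =
  fixes g G :: "real \<Rightarrow> real" and \<alpha> \<beta> L :: real
  assumes lip: "L-lipschitz_on UNIV g"
    and \<alpha>: "0 < \<alpha>" "\<alpha> < \<beta>" "\<beta> \<le> 1"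
    and g_zero: "\<And>x. x \<le> 0 \<or> x = \<alpha> \<or> 1 \<le> x \<Longrightarrow> g x = 0"
    and g_neg: "\<And>x. 0 < x \<Longrightarrow> x < \<alpha> \<Longrightarrow> g x < 0"
    and g_pos: "\<And>x. \<alpha> < x \<Longrightarrow> x < 1 \<Longrightarrow> g x > 0"
    and G_deriv: "\<And>x. (G has_real_derivative g x) (at x)"
    and G_0: "G 0 = 0" and G_\<beta>: "G \<beta> = 0"
begin

section \<open>The shape of the potential\<close>

lemma g_zero_cases:
  assumes "g x = 0" "0 \<le> x" "x \<le> 1" shows "x = 0 \<or> x = \<alpha> \<or> x = 1"
  using assms g_neg[of x] g_pos[of x] by force

lemma G_cont: "continuous_on S G"
  using G_deriv by (intro DERIV_continuous_on) (auto intro: DERIV_subset)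

lemma isCont_G: "isCont G x"
  using G_deriv by (rule DERIV_isCont)

lemma isCont_g: "isCont g x"
  using lipschitz_on_continuous_on[OF lip] by (simp add: continuous_on_eq_continuous_at)

lemma G_dec: assumes "0 \<le> x" "x < y" "y \<le> \<alpha>" shows "G y < G x"
  using assms G_deriv g_neg by (intro DERIV_neg_imp_decreasing_open[OF assms(2) _ G_cont]) force

lemma G_inc: assumes "\<alpha> \<le> x" "x < y" "y \<le> 1" shows "G x < G y"
  using assms G_deriv g_pos by (intro DERIV_pos_imp_increasing_open[OF assms(2) _ G_cont]) force

lemma G_le_0: assumes "x \<le> 0" shows "G x = 0"
proof -
  have "(G has_real_derivative 0) (at y)" if "y < 0" for y
    using G_deriv[of y] g_zero[of y] that by simp
  then have "G x = G 0"
    using DERIV_isconst_end[OF _ G_cont, of x 0] assms by (cases "x = 0") auto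
  then show ?thesis using G_0 by simp
qed

lemma G_ge_1: assumes "x \<ge> 1" shows "G x = G 1"
proof -
  have "(G has_real_derivative 0) (at y)" if "y > 1" for y
    using G_deriv[of y] g_zero[of y] that by simp
  then show ?thesis
    using DERIV_isconst_end[OF _ G_cont, of 1 x] assms by (cases "x = 1") auto
qed

lemma G_neg: assumes "0 < x" "x < \<beta>" shows "G x < 0"
  using G_dec[of 0 x] G_inc[of x \<beta>] assms \<alpha> G_0 G_\<beta> by (cases "x \<le> \<alpha>") auto

lemma G_nonneg: assumes "\<beta> \<le> x" shows "0 \<le> G x"
proof (cases "x \<le> 1")
  case True
  then show ?thesis using G_inc[of \<beta> x] assms \<alpha> G_\<beta> by (cases "x = \<beta>") auto
next
  case False
  then show ?thesis using G_ge_1[of x] G_inc[of \<beta> 1] \<alpha> G_\<beta> by (cases "\<beta> = 1") auto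
qed

lemma G_pos: assumes "\<beta> < x" "\<beta> < 1" shows "0 < G x"
proof (cases "x \<le> 1")
  case True
  then show ?thesis using G_inc[of \<beta> x] assms \<alpha> G_\<beta> by auto
next
  case False
  then show ?thesis using G_ge_1[of x] G_inc[of \<beta> 1] assms \<alpha> G_\<beta> by auto
qed

lemma G_less_G_1: assumes "0 < x" "x < 1" shows "G x < G 1"
  using G_dec[of 0 x] G_inc[of x 1] G_nonneg[of 1] assms \<alpha> G_0 by (cases "x \<le> \<alpha>") auto

text \<open>The bottom of the potential well. It bounds the momentum in terms of the energy and
  leaves rest at \<alpha> as the only state on the level of \<alpha>.\<close>

lemma G_\<alpha>_less: assumes "x \<noteq> \<alpha>" shows "G \<alpha> < G x"
proof -
  have "G \<alpha> < 0" using G_neg[of \<alpha>] \<alpha> by simp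
  then show ?thesis
    using G_le_0[of x] G_dec[of x \<alpha>] G_inc[of \<alpha> x] G_nonneg[of x] assms \<alpha> by force
qed

text \<open>The relativistic Hamiltonian, kinetic plus potential energy, with the rest energy 1
  subtracted so that the equilibrium 0 has level 0.\<close>

definition energy :: "real \<Rightarrow> real \<Rightarrow> real \<Rightarrow> real" where
  "energy k x w = sqrt (1 + w\<^sup>2) - 1 + k * G x"

lemma energy_conserved:
  assumes o: "half_orbit g k x w" and t: "t \<ge> 0"
  shows "energy k (x t) (w t) = energy k (x 0) (w 0)"
proof -
  have "((\<lambda>t. energy k (x t) (w t)) has_real_derivative 0) (at t within {0..})" if "t \<ge> 0" for t
  proof -
    note d = half_orbitD[OF o that]
    have 1: "((\<lambda>t. sqrt (1 + (w t)\<^sup>2)) has_real_derivative velocity (w t) * (- k * g (x t))) (at t within {0..})"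
      by (rule DERIV_chain2[OF sqrt_one_plus_square_deriv d(2)])
    have 2: "((\<lambda>t. G (x t)) has_real_derivative g (x t) * velocity (w t)) (at t within {0..})"
      by (rule DERIV_chain2[OF G_deriv d(1)])
    show ?thesis unfolding energy_def
      by (rule derivative_eq_intros 1 2 refl)+ simp
  qed
  then have "\<exists>c. \<forall>t\<in>{0..}. energy k (x t) (w t) = c"
    by (intro has_field_derivative_zero_constant) auto
  then show ?thesis using t by force
qed

lemma sqrt_one_plus_square_minus_one [simp]:
  "sqrt (1 + w\<^sup>2) - 1 \<ge> 0" "sqrt (1 + w\<^sup>2) - 1 = 0 \<longleftrightarrow> w = 0" for w :: real
  by auto

text \<open>Uniqueness works in both time directions, so \<open>t\<close> may precede
  \<open>s\<close>: a nonconstant orbit cannot reach an equilibrium in finite time.\<close>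

lemma half_orbit_equilibrium:
  assumes o: "half_orbit g k x w" and "g l = 0" and s: "s \<ge> 0" "x s = l" "w s = 0" and t: "t \<ge> 0"
  shows "x t = l"
proof -
  have "half_orbit g k (\<lambda>_. l) (\<lambda>_. 0)" using assms(2) by (simp add: half_orbit_def)
  from half_orbit_unique[OF lip o this s(1) _ _ t] s show ?thesis by simp
qed

lemma half_orbit_ivt:
  assumes o: "half_orbit g k x w" and t: "t \<ge> 0" and "x 0 \<le> c \<and> c \<le> x t \<or> x t \<le> c \<and> c \<le> x 0"
  obtains s where "s \<ge> 0" "x s = c"
proof -
  have "continuous_on {0..t} x" by (rule continuous_on_subset[OF half_orbit_continuous(1)[OF o]]) auto
  then show ?thesis using IVT'[of x 0 c t] IVT2'[of x t c 0] assms(3) t that by blast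
qed

lemma half_orbit_dec:
  assumes o: "half_orbit g k x w" and ab: "0 \<le> a" "a < b" and neg: "\<And>t. a < t \<Longrightarrow> t < b \<Longrightarrow> w t < 0"
  shows "x b < x a"
  using ray_pos_deriv_imp_less[of "\<lambda>t. - x t" "\<lambda>t. - velocity (w t)", OF _ ab] half_orbitD[OF o] neg
  by (auto intro: DERIV_minus)

lemma half_orbit_inc:
  assumes o: "half_orbit g k x w" and ab: "0 \<le> a" "a < b" and pos: "\<And>t. a < t \<Longrightarrow> t < b \<Longrightarrow> w t > 0"
  shows "x a < x b"
  using ray_pos_deriv_imp_less[of x "\<lambda>t. velocity (w t)", OF _ ab] half_orbitD[OF o] pos
  by auto

text \<open>A momentum of constant sign makes \<open>x\<close> monotone, hence convergent; energy
  conservation then makes \<open>w\<close> converge too. A bounded function whose derivative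
  converges has derivative limit 0: applied to \<open>x\<close> this gives w -> 0, applied to
  \<open>w\<close> it gives \<open>g l = 0\<close>.\<close>

lemma monotone_orbit_tends_to_equilibrium:
  assumes k: "k > 0" and o: "half_orbit g k x w" and nz: "\<And>t. t \<ge> 0 \<Longrightarrow> w t \<noteq> 0"
    and bd: "\<And>t. t \<ge> 0 \<Longrightarrow> a \<le> x t \<and> x t \<le> b"
  shows "\<exists>l. (x \<longlongrightarrow> l) at_top \<and> a \<le> l \<and> l \<le> b \<and> g l = 0 \<and> energy k (x 0) (w 0) = k * G l"
proof -
  define E where "E = energy k (x 0) (w 0)"
  have E: "sqrt (1 + (w t)\<^sup>2) = 1 + E - k * G (x t)" if "t \<ge> 0" for t
    using energy_conserved[OF o that] by (simp add: E_def energy_def)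
  have sign: "(\<forall>t\<ge>0. w t > 0) \<or> (\<forall>t\<ge>0. w t < 0)"
    by (rule ray_nonzero_sign[OF half_orbit_continuous(2)[OF o] nz])
  have "\<exists>l. (x \<longlongrightarrow> l) at_top"
  proof (cases "\<forall>t\<ge>0. w t > 0")
    case True
    then have "x s \<le> x t" if "0 \<le> s" "s \<le> t" for s t
      using half_orbit_inc[OF o, of s t] that by (cases "s = t") auto
    then show ?thesis using bd ray_mono_bounded_convergent[of x b] by blast
  next
    case False
    then have "x t \<le> x s" if "0 \<le> s" "s \<le> t" for s t
      using sign half_orbit_dec[OF o, of s t] that by (cases "s = t") auto
    then have "\<exists>l. ((\<lambda>t. - x t) \<longlongrightarrow> l) at_top"
      using bd by (intro ray_mono_bounded_convergent[of _ "- a"]) auto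
    then show ?thesis using tendsto_minus by fastforce
  qed
  then obtain l where l: "(x \<longlongrightarrow> l) at_top" by blast
  have ev: "eventually (\<lambda>t. t \<ge> (0::real)) at_top" by (rule eventually_ge_at_top)
  have "a \<le> l"
    by (rule tendsto_lowerbound[OF l eventually_mono[OF ev]]) (use bd in auto)
  moreover have "l \<le> b"
    by (rule tendsto_upperbound[OF l eventually_mono[OF ev]]) (use bd in auto)
  moreover have "g l = 0" "E = k * G l"
  proof -
    have limG: "((\<lambda>t. G (x t)) \<longlongrightarrow> G l) at_top" by (rule isCont_tendsto_compose[OF isCont_G l])
    \<comment> \<open>The limit of \<open>\<bar>w t\<bar>\<close>, obtained by solving the energy
      identity for it; the constant sign of \<open>w\<close> then removes the absolute
      value.\<close>
    define m where "m = sqrt ((1 + E - k * G l)\<^sup>2 - 1)"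
    have "((\<lambda>t. sqrt ((1 + E - k * G (x t))\<^sup>2 - 1)) \<longlongrightarrow> m) at_top"
      unfolding m_def by (intro tendsto_intros limG)
    moreover have "sqrt ((1 + E - k * G (x t))\<^sup>2 - 1) = \<bar>w t\<bar>" if "t \<ge> 0" for t
      by (simp add: E[OF that, symmetric])
    ultimately have absw: "((\<lambda>t. \<bar>w t\<bar>) \<longlongrightarrow> m) at_top"
      by (rule Lim_transform_eventually[OF _ eventually_mono[OF ev]])
    obtain n where n: "(w \<longlongrightarrow> n) at_top"
    proof (cases "\<forall>t\<ge>0. w t > 0")
      case True
      then have "(w \<longlongrightarrow> m) at_top"
        by (intro Lim_transform_eventually[OF absw eventually_mono[OF ev]]) auto
      then show ?thesis by (rule that)
    next
      case False
      then have "(w \<longlongrightarrow> - m) at_top"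
        using sign by (intro Lim_transform_eventually[OF tendsto_minus[OF absw] eventually_mono[OF ev]]) auto
      then show ?thesis by (rule that)
    qed
    have "velocity n = 0"
    proof (rule ray_bounded_deriv_limit_zero)
      show "(x has_real_derivative velocity (w t)) (at t within {0..})" if "t \<ge> 0" for t
        using half_orbitD[OF o that] by simp
      show "((\<lambda>t. velocity (w t)) \<longlongrightarrow> velocity n) at_top" by (intro tendsto_intros n)
      show "\<bar>x t\<bar> \<le> \<bar>a\<bar> + \<bar>b\<bar>" if "t \<ge> 0" for t using bd[OF that] by auto
    qed
    then have n0: "(w \<longlongrightarrow> 0) at_top" using n by simp
    have "((\<lambda>t. sqrt (1 + (w t)\<^sup>2)) \<longlongrightarrow> sqrt (1 + 0\<^sup>2)) at_top" by (intro tendsto_intros n0)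
    moreover have "((\<lambda>t. sqrt (1 + (w t)\<^sup>2)) \<longlongrightarrow> 1 + E - k * G l) at_top"
      by (rule Lim_transform_eventually[OF _ eventually_mono[OF ev]])
        (use limG E in \<open>auto intro!: tendsto_intros\<close>)
    ultimately have "sqrt (1 + 0\<^sup>2) = 1 + E - k * G l" by (rule tendsto_unique[rotated]) simp
    then show "E = k * G l" by simp
    have "- k * g l = 0"
    proof (rule ray_bounded_deriv_limit_zero)
      show "(w has_real_derivative - k * g (x t)) (at t within {0..})" if "t \<ge> 0" for t
        using half_orbitD[OF o that] by simp
      show "((\<lambda>t. - k * g (x t)) \<longlongrightarrow> - k * g l) at_top"
        by (intro tendsto_intros isCont_tendsto_compose[OF isCont_g l])
      \<comment> \<open>The potential is smallest at \<alpha>, so the kinetic part is largest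
        there.\<close>
      show "\<bar>w t\<bar> \<le> 1 + E - k * G \<alpha>" if "t \<ge> 0" for t
      proof -
        have "G \<alpha> \<le> G (x t)" using G_\<alpha>_less[of "x t"] by (cases "x t = \<alpha>") auto
        then have "k * G \<alpha> \<le> k * G (x t)" using k by simp
        then show ?thesis using E[OF that] sqrt_one_plus_square_gt[of "w t"] by linarith
      qed
    qed
    then show "g l = 0" using k by simp
  qed
  ultimately show ?thesis using l by (auto simp: E_def)
qed

lemma eventually_monotone_orbit:
  assumes k: "k > 0" and o: "half_orbit g k x w" and s: "s \<ge> 0" and nz: "\<And>t. t \<ge> s \<Longrightarrow> w t \<noteq> 0"
    and bd: "\<And>t. t \<ge> s \<Longrightarrow> a \<le> x t \<and> x t \<le> b"
  shows "\<exists>l. (x \<longlongrightarrow> l) at_top \<and> a \<le> l \<and> l \<le> b \<and> g l = 0 \<and> energy k (x 0) (w 0) = k * G l"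
  using monotone_orbit_tends_to_equilibrium[OF k half_orbit_shift[OF o s], of a b] nz bd s
    energy_conserved[OF o s] by (simp add: tendsto_at_top_shift)

text \<open>Convergence of the momentum is not assumed. If the energy were nonzero, the potential
  term would eventually be smaller in modulus, so \<open>w\<close> could not vanish at late times;
  the orbit would tend to an equilibrium on its own level, and this equilibrium is 0.\<close>

lemma vanishing_orbit_energy:
  assumes k: "k > 0" and o: "half_orbit g k x w" and lim: "(x \<longlongrightarrow> 0) at_top"
  shows "energy k (x 0) (w 0) = 0"
proof (rule ccontr)
  define E where "E = energy k (x 0) (w 0)"
  assume "energy k (x 0) (w 0) \<noteq> 0"
  then have E0: "E \<noteq> 0" by (simp add: E_def)
  have limG: "((\<lambda>t. k * G (x t)) \<longlongrightarrow> k * G 0) at_top"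
    by (intro tendsto_intros isCont_tendsto_compose[OF isCont_G lim])
  have "eventually (\<lambda>t. dist (k * G (x t)) (k * G 0) < \<bar>E\<bar>) at_top"
    by (rule tendstoD[OF limG]) (use E0 in simp)
  moreover have "eventually (\<lambda>t. dist (x t) 0 < 1) at_top" by (rule tendstoD[OF lim]) simp
  ultimately have "eventually (\<lambda>t. t \<ge> 0 \<and> \<bar>k * G (x t)\<bar> < \<bar>E\<bar> \<and> \<bar>x t\<bar> < 1) at_top"
    using eventually_ge_at_top[of 0] by eventually_elim (simp add: G_0)
  then obtain s0 where s0: "\<And>t. t \<ge> s0 \<Longrightarrow> t \<ge> 0 \<and> \<bar>k * G (x t)\<bar> < \<bar>E\<bar> \<and> \<bar>x t\<bar> < 1"
    by (auto simp: eventually_at_top_linorder)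
  have "s0 \<ge> 0" using s0[of s0] by simp
  moreover have "w t \<noteq> 0" if "t \<ge> s0" for t
    using s0[OF that] energy_conserved[OF o, of t] by (auto simp: energy_def E_def)
  moreover have "-1 \<le> x t \<and> x t \<le> 1" if "t \<ge> s0" for t
    using s0[OF that] by (auto simp: abs_less_iff)
  ultimately obtain l where "(x \<longlongrightarrow> l) at_top" "E = k * G l"
    unfolding E_def using eventually_monotone_orbit[OF k o] by blast
  then have "E = k * G 0" using tendsto_unique[OF _ lim] by force
  then show False using E0 G_0 by simp
qed

text \<open>On the zero level \<open>G \<le> 0\<close>, and a point where \<open>g\<close> and
  \<open>G\<close> both vanish can only be passed with \<open>w = 0\<close>, that is, at rest. This
  bars a nontrivial orbit from all x <= 0 and all x >= 1.\<close>

lemma vanishing_orbit_range: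
  assumes k: "k > 0" and o: "half_orbit g k x w" and lim: "(x \<longlongrightarrow> 0) at_top"
  shows "(\<forall>t\<ge>0. x t = 0) \<or> (\<forall>t\<ge>0. 0 < x t \<and> x t \<le> \<beta> \<and> x t < 1)"
proof (cases "\<forall>t\<ge>0. x t = 0")
  case False
  have E: "sqrt (1 + (w t)\<^sup>2) - 1 + k * G (x t) = 0" if "t \<ge> 0" for t
    using energy_conserved[OF o that] vanishing_orbit_energy[OF assms] by (simp add: energy_def)
  have noeq: "\<not> (g (x s) = 0 \<and> w s = 0)" if "s \<ge> 0" for s
  proof
    assume s: "g (x s) = 0 \<and> w s = 0"
    then have c: "x t = x s" if "t \<ge> 0" for t
      using half_orbit_equilibrium[OF o _ \<open>s \<ge> 0\<close> refl, of t] that by simp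
    have "eventually (\<lambda>t. x t = x s) at_top"
      using eventually_ge_at_top[of 0] by eventually_elim (rule c)
    then have "((\<lambda>t::real. x s) \<longlongrightarrow> 0) at_top" by (rule Lim_transform_eventually[OF lim])
    then have "x s = 0" by (simp add: tendsto_const_iff)
    then show False using c False by simp
  qed
  have noeq': "\<not> (g (x s) = 0 \<and> G (x s) = 0)" if "s \<ge> 0" for s
    using noeq[OF that] E[OF that] by auto
  have "0 < x t \<and> x t \<le> \<beta> \<and> x t < 1" if t: "t \<ge> 0" for t
  proof -
    have "0 < x t" using noeq'[OF t] g_zero[of "x t"] G_le_0[of "x t"] by force
    moreover have "k * G (x t) \<le> 0"
      using E[OF t] sqrt_one_plus_square_minus_one(1)[of "w t"] by linarith
    then have G: "G (x t) \<le> 0" using k by (simp add: mult_le_0_iff)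
    have "x t < 1"
    proof (rule ccontr)
      assume "\<not> x t < 1"
      then have "x t \<ge> 1" by simp
      then have "G (x t) = 0" using G G_nonneg[of "x t"] \<alpha> by simp
      then show False using noeq'[OF t] g_zero[of "x t"] \<open>x t \<ge> 1\<close> by simp
    qed
    moreover have "x t \<le> \<beta>" using G_pos[of "x t"] G \<open>x t < 1\<close> by force
    ultimately show ?thesis by simp
  qed
  then show ?thesis by blast
qed simp

text \<open>Zero energy at x = 0 forces \<open>w = 0\<close>, and that equilibrium is out of
  reach.\<close>

lemma zero_energy_orbit_pos:
  assumes o: "half_orbit g k x w" and E: "energy k (x 0) (w 0) = 0"
    and x0: "0 < x 0" and t: "t \<ge> 0"
  shows "0 < x t"
proof (rule ccontr)
  assume "\<not> 0 < x t"
  then obtain s where s: "s \<ge> 0" "x s = 0" using half_orbit_ivt[OF o t, of 0] x0 by auto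
  then have "sqrt (1 + (w s)\<^sup>2) - 1 = 0"
    using energy_conserved[OF o s(1)] G_0 unfolding E by (simp add: energy_def)
  then have "w s = 0" by simp
  then have "x 0 = 0" using half_orbit_equilibrium[OF o _ s, of 0] g_zero[of 0] by simp
  then show False using x0 by simp
qed

text \<open>On the zero level with x > 0 the momentum vanishes only at \<beta>, where its derivative
  \<open>- k * g \<beta>\<close> is negative. So the orbit leaves the turning point downwards and
  never turns again; its limit is a zero of \<open>G\<close> below \<beta>.\<close>

lemma homoclinic_half_orbit:
  assumes k: "k > 0" and o: "half_orbit g k x w" and \<beta>: "\<beta> < 1" "x 0 = \<beta>" "w 0 = 0"
  shows "(x \<longlongrightarrow> 0) at_top" "\<And>a b. 0 \<le> a \<Longrightarrow> a < b \<Longrightarrow> x b < x a"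
proof -
  have E0: "energy k (x 0) (w 0) = 0" using \<beta> by (simp add: energy_def G_\<beta>)
  have E: "sqrt (1 + (w t)\<^sup>2) - 1 + k * G (x t) = 0" if "t \<ge> 0" for t
    using energy_conserved[OF o that] E0 by (simp add: energy_def)
  have pos: "0 < x t" if "t \<ge> 0" for t using zero_energy_orbit_pos[OF o E0 _ that] \<beta> \<alpha> by simp
  have neg: "w t < 0" if "t > 0" for t
  proof (rule ray_transversal_zero_unique[OF half_orbitD(2)[OF o], of 0])
    fix s :: real assume s: "s \<ge> 0" "w s = 0"
    then have "G (x s) = 0" using E[OF s(1)] k by simp
    then have "x s = \<beta>" using G_neg[of "x s"] G_pos[of "x s"] pos[OF s(1)] \<beta>(1) by force
    then show "- k * g (x s) < 0" using g_pos[of \<beta>] \<alpha> \<beta>(1) k by simp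
  qed (use \<beta> that in auto)
  then show dec: "x b < x a" if "0 \<le> a" "a < b" for a b
    using half_orbit_dec[OF o that] that by simp
  \<comment> \<open>Starting at time 1 avoids the zero of \<open>w\<close> at time 0 and keeps the
    limit strictly below \<beta>.\<close>
  have le: "0 \<le> x t \<and> x t \<le> x 1" if "t \<ge> 1" for t
    using pos[of t] dec[of 1 t] that by (cases "t = 1") auto
  have nz: "w t \<noteq> 0" if "t \<ge> 1" for t using neg[of t] that by simp
  obtain l where l: "(x \<longlongrightarrow> l) at_top" "0 \<le> l" "l \<le> x 1" "energy k (x 0) (w 0) = k * G l"
    using eventually_monotone_orbit[OF k o zero_le_one nz le] by blast
  have "G l = 0" using l(4) E0 k by simp
  moreover have "l < \<beta>" using l(3) dec[of 0 1] \<beta> by simp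
  ultimately have "l = 0" using G_neg[of l] l(2) by force
  then show "(x \<longlongrightarrow> 0) at_top" using l(1) by simp
qed

text \<open>As long as \<open>w < 0\<close>, the orbit stays below its initial height, where
  \<open>G < 0\<close>, and zero energy forbids \<open>w = 0\<close>. After time reversal this is
  the left half of a heteroclinic.\<close>

lemma decaying_half_orbit:
  assumes k: "k > 0" and o: "half_orbit g k x w" and x0: "0 < x 0" "x 0 < \<beta>" and w0: "w 0 < 0"
    and E0: "energy k (x 0) (w 0) = 0"
  shows "(x \<longlongrightarrow> 0) at_top" "\<And>a b. 0 \<le> a \<Longrightarrow> a < b \<Longrightarrow> x b < x a" "\<And>t. t \<ge> 0 \<Longrightarrow> 0 < x t"
proof -
  have E: "sqrt (1 + (w t)\<^sup>2) - 1 + k * G (x t) = 0" if "t \<ge> 0" for t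
    using energy_conserved[OF o that] E0 by (simp add: energy_def)
  show pos: "0 < x t" if "t \<ge> 0" for t using zero_energy_orbit_pos[OF o E0 x0(1) that] .
  have neg: "w t < 0" if "t \<ge> 0" for t
  proof (rule ray_first_zero[OF half_orbit_continuous(2)[OF o] w0 _ that])
    fix t :: real assume t: "t > 0" "\<And>s. 0 \<le> s \<Longrightarrow> s < t \<Longrightarrow> w s < 0"
    have "x t < x 0" using half_orbit_dec[OF o _ t(1)] t(2) by simp
    then have "G (x t) < 0" using G_neg[of "x t"] pos[of t] t(1) x0 by simp
    then show "w t \<noteq> 0" using E[of t] t(1) k by (auto simp: mult_eq_0_iff)
  qed
  show dec: "x b < x a" if "0 \<le> a" "a < b" for a b
    using half_orbit_dec[OF o that] neg that by simp
  have le: "0 \<le> x t \<and> x t \<le> x 0" if "t \<ge> 0" for t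
    using pos[of t] dec[of 0 t] that by (cases "t = 0") auto
  have nz: "w t \<noteq> 0" if "t \<ge> 0" for t using neg[OF that] by simp
  obtain l where l: "(x \<longlongrightarrow> l) at_top" "0 \<le> l" "l \<le> x 0" "energy k (x 0) (w 0) = k * G l"
    using eventually_monotone_orbit[OF k o order_refl nz le] by blast
  have "G l = 0" using l(4) E0 k by simp
  then have "l = 0" using G_neg[of l] l x0 by force
  then show "(x \<longlongrightarrow> 0) at_top" using l(1) by simp
qed

text \<open>The right half of a heteroclinic. On the level of 1 the momentum cannot vanish inside
  ]0,1[, since \<open>G x < G 1\<close> there, and 1 could be attained only at rest.\<close>

lemma front_half_orbit:
  assumes k: "k > 0" and o: "half_orbit g k x w" and x0: "0 < x 0" "x 0 < 1" and w0: "w 0 > 0"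
    and E0: "energy k (x 0) (w 0) = k * G 1"
  shows "(x \<longlongrightarrow> 1) at_top" "\<And>a b. 0 \<le> a \<Longrightarrow> a < b \<Longrightarrow> x a < x b" "\<And>t. t \<ge> 0 \<Longrightarrow> x t < 1"
proof -
  have E: "sqrt (1 + (w t)\<^sup>2) - 1 + k * G (x t) = k * G 1" if "t \<ge> 0" for t
    using energy_conserved[OF o that] E0 by (simp add: energy_def)
  show lt1: "x t < 1" if t: "t \<ge> 0" for t
  proof (rule ccontr)
    assume "\<not> x t < 1"
    then obtain s where s: "s \<ge> 0" "x s = 1" using half_orbit_ivt[OF o t, of 1] x0 by auto
    then have "w s = 0" using E[OF s(1)] by simp
    then have "x 0 = 1" using half_orbit_equilibrium[OF o _ s, of 0] g_zero[of 1] by simp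
    then show False using x0 by simp
  qed
  have "- w t < 0" if "t \<ge> 0" for t
  proof (rule ray_first_zero[of "\<lambda>t. - w t", OF _ _ _ that])
    show "continuous_on {0..} (\<lambda>t. - w t)" by (intro continuous_intros half_orbit_continuous(2)[OF o])
    fix t :: real assume t: "t > 0" "\<And>s. 0 \<le> s \<Longrightarrow> s < t \<Longrightarrow> - w s < 0"
    have "x 0 < x t" using half_orbit_inc[OF o _ t(1)] t(2) by simp
    then have "G (x t) < G 1" using G_less_G_1[of "x t"] lt1[of t] t(1) x0 by simp
    then show "- w t \<noteq> 0" using E[of t] t(1) k by auto
  qed (use w0 in simp)
  then have pos: "w t > 0" if "t \<ge> 0" for t using that by simp
  show inc: "x a < x b" if "0 \<le> a" "a < b" for a b
    using half_orbit_inc[OF o that] pos that by simp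
  have le: "x 0 \<le> x t \<and> x t \<le> 1" if "t \<ge> 0" for t
    using lt1[of t] inc[of 0 t] that by (cases "t = 0") auto
  have nz: "w t \<noteq> 0" if "t \<ge> 0" for t using pos[OF that] by simp
  obtain l where l: "(x \<longlongrightarrow> l) at_top" "x 0 \<le> l" "l \<le> 1" "energy k (x 0) (w 0) = k * G l"
    using eventually_monotone_orbit[OF k o order_refl nz le] by blast
  have "G l = G 1" using l(4) E0 k by simp
  then have "l = 1" using G_less_G_1[of l] l x0 by force
  then show "(x \<longlongrightarrow> 1) at_top" using l(1) by simp
qed

text \<open>At a zero of \<open>w\<close> the energy determines \<open>x\<close> up to the two branches of \<open>G\<close>, so among three zeros
  two are at the same phase point.\<close>

lemma negative_energy_periodic:
  assumes k: "k > 0" and o: "half_orbit g k x w" and E0: "energy k (x 0) (w 0) < 0"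
  shows "\<exists>T>0. \<forall>t\<ge>0. x t = x (t + T)"
proof -
  define E where "E = energy k (x 0) (w 0)"
  have E: "sqrt (1 + (w t)\<^sup>2) - 1 + k * G (x t) = E" if "t \<ge> 0" for t
    using energy_conserved[OF o that] by (simp add: energy_def E_def)
  have range: "0 < x t \<and> x t < \<beta>" if "t \<ge> 0" for t
  proof -
    have "k * G (x t) < 0"
      using E[OF that] E0 sqrt_one_plus_square_minus_one(1)[of "w t"] unfolding E_def by linarith
    then have "G (x t) < 0" using k by (simp add: mult_less_0_iff)
    then show ?thesis using G_le_0[of "x t"] G_nonneg[of "x t"] by force
  qed
  \<comment> \<open>Otherwise the orbit would converge to an equilibrium of negative level,
    necessarily \<alpha>; on the level of \<alpha> the momentum vanishes identically.\<close>
  have zero: "\<exists>t\<ge>s. w t = 0" if s: "s \<ge> 0" for s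
  proof (rule ccontr)
    assume nz: "\<not> (\<exists>t\<ge>s. w t = 0)"
    have "0 \<le> x t \<and> x t \<le> \<beta>" if "t \<ge> s" for t using range[of t] s that by simp
    then obtain l where l: "0 \<le> l" "l \<le> \<beta>" "g l = 0" "E = k * G l"
      unfolding E_def using eventually_monotone_orbit[OF k o s, of 0 \<beta>] nz by blast
    have "l \<noteq> 0" "l \<noteq> 1" using l(4) E0 k G_0 G_nonneg[of 1] \<alpha> by (auto simp: E_def mult_less_0_iff)
    then have "l = \<alpha>" using g_zero_cases[of l] l \<alpha> by auto
    then have "E = k * G \<alpha>" using l(4) by simp
    moreover have "G \<alpha> \<le> G (x s)" using G_\<alpha>_less[of "x s"] by (cases "x s = \<alpha>") auto
    then have "k * G \<alpha> \<le> k * G (x s)" using k by simp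
    ultimately have "sqrt (1 + (w s)\<^sup>2) - 1 = 0"
      using E[OF s] sqrt_one_plus_square_minus_one(1)[of "w s"] by linarith
    then show False using nz by auto
  qed
  obtain t1 where t1: "t1 \<ge> 0" "w t1 = 0" using zero[of 0] by auto
  obtain t2 where t2: "t2 \<ge> t1 + 1" "w t2 = 0" using zero[of "t1 + 1"] t1 by auto
  obtain t3 where t3: "t3 \<ge> t2 + 1" "w t3 = 0" using zero[of "t2 + 1"] t1 t2 by auto
  have Geq: "G (x s) = G (x t)" if "s \<ge> 0" "w s = 0" "t \<ge> 0" "w t = 0" for s t
  proof -
    have "k * G (x s) = k * G (x t)" using E[of s] E[of t] that by simp
    then show ?thesis using k by simp
  qed
  have same: "x s = x t" if "s \<ge> 0" "w s = 0" "t \<ge> 0" "w t = 0" "x s \<le> \<alpha> \<longleftrightarrow> x t \<le> \<alpha>" for s t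
    using Geq[OF that(1-4)] range[OF that(1)] range[OF that(3)] that(5) \<alpha>
      G_dec[of "x s" "x t"] G_dec[of "x t" "x s"] G_inc[of "x s" "x t"] G_inc[of "x t" "x s"]
    by (smt (verit))
  have nonneg: "t2 \<ge> 0" "t3 \<ge> 0" using t1 t2 t3 by auto
  have less: "t1 < t2" "t1 < t3" "t2 < t3" using t2 t3 by auto
  consider "x t1 \<le> \<alpha> \<longleftrightarrow> x t2 \<le> \<alpha>" | "x t1 \<le> \<alpha> \<longleftrightarrow> x t3 \<le> \<alpha>" | "x t2 \<le> \<alpha> \<longleftrightarrow> x t3 \<le> \<alpha>"
    by blast
  then obtain s s' where s: "0 \<le> s" "s < s'" "x s = x s'" "w s = 0" "w s' = 0"
  proof cases
    case 1
    show ?thesis using that[OF t1(1) less(1) same[OF t1 nonneg(1) t2(2) 1] t1(2) t2(2)] .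
  next
    case 2
    show ?thesis using that[OF t1(1) less(2) same[OF t1 nonneg(2) t3(2) 2] t1(2) t3(2)] .
  next
    case 3
    show ?thesis using that[OF nonneg(1) less(3) same[OF nonneg(1) t2(2) nonneg(2) t3(2) 3] t2(2) t3(2)] .
  qed
  \<comment> \<open>The orbit and its translate agree at \<open>s\<close>; since uniqueness also
    runs backwards, they agree from time 0 on.\<close>
  have "\<forall>t\<ge>0. x t = x (t + (s' - s))"
  proof (intro allI impI)
    fix t :: real assume t: "t \<ge> 0"
    have "s' - s \<ge> 0" using s(2) by simp
    moreover have "x s = x (s + (s' - s))" "w s = w (s + (s' - s))" using s(3-5) by simp_all
    ultimately show "x t = x (t + (s' - s))"
      using half_orbit_unique[OF lip o half_orbit_shift[OF o] s(1) _ _ t] by blast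
  qed
  moreover have "s' - s > 0" using s(2) by simp
  ultimately show ?thesis by blast
qed

lemma positive_energy_exits:
  assumes k: "k > 0" and o: "half_orbit g k x w" and x0: "0 < x 0" "x 0 < 1"
    and E0: "energy k (x 0) (w 0) > 0" "energy k (x 0) (w 0) \<noteq> k * G 1"
  shows "\<exists>t\<ge>0. (x t = 0 \<or> x t = 1) \<and> w t \<noteq> 0"
proof (rule ccontr)
  define E where "E = energy k (x 0) (w 0)"
  assume no: "\<not> (\<exists>t\<ge>0. (x t = 0 \<or> x t = 1) \<and> w t \<noteq> 0)"
  have E: "sqrt (1 + (w t)\<^sup>2) - 1 + k * G (x t) = E" if "t \<ge> 0" for t
    using energy_conserved[OF o that] by (simp add: energy_def E_def)
  \<comment> \<open>Under \<open>no\<close> the values 0 and 1 could be taken only with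
    \<open>w = 0\<close>, which would put the energy at 0 or at \<open>k * G 1\<close>.\<close>
  have never: "x t \<noteq> 0 \<and> x t \<noteq> 1" if "t \<ge> 0" for t
    using E[OF that] no that E0 G_0 by (auto simp: E_def)
  have range: "0 < x t \<and> x t < 1" if t: "t \<ge> 0" for t
  proof (rule ccontr)
    assume "\<not> (0 < x t \<and> x t < 1)"
    then consider "x t \<le> 0" | "1 \<le> x t" by linarith
    then show False
    proof cases
      case 1
      then obtain s where "s \<ge> 0" "x s = 0" using half_orbit_ivt[OF o t, of 0] x0 by auto
      then show False using never by blast
    next
      case 2
      then obtain s where "s \<ge> 0" "x s = 1" using half_orbit_ivt[OF o t, of 1] x0 by auto
      then show False using never by blast
    qed
  qed
  have "\<exists>s\<ge>0. \<forall>t\<ge>s. w t \<noteq> 0"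
  proof (cases "\<exists>s\<ge>0. w s = 0")
    case True
    then obtain s where s: "s \<ge> 0" "w s = 0" by blast
    have "w t < 0" if "t > s" for t
    proof (rule ray_transversal_zero_unique[OF half_orbitD(2)[OF o] _ s that])
      \<comment> \<open>Positive energy places every zero of \<open>w\<close> where
        \<open>G > 0\<close>, hence at a height of at least \<beta>, to the right of \<alpha>, where
        the momentum decreases.\<close>
      fix r :: real assume r: "r \<ge> 0" "w r = 0"
      then have "k * G (x r) > 0" using E[OF r(1)] E0 by (simp add: E_def)
      then have "G (x r) > 0" using k by (simp add: zero_less_mult_iff)
      then have "\<beta> \<le> x r" using G_neg[of "x r"] range[OF r(1)] by force
      then show "- k * g (x r) < 0" using g_pos[of "x r"] range[OF r(1)] \<alpha> k by simp
    qed
    then have "w t \<noteq> 0" if "t \<ge> s + 1" for t using that by (metis less_add_one less_irrefl less_le_trans)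
    then show ?thesis using s(1) by (intro exI[of _ "s + 1"]) simp
  qed (auto intro!: exI[of _ 0])
  then obtain s where s: "s \<ge> 0" "\<And>t. t \<ge> s \<Longrightarrow> w t \<noteq> 0" by blast
  have "0 \<le> x t \<and> x t \<le> 1" if "t \<ge> s" for t using range[of t] s(1) that by simp
  then obtain l where l: "0 \<le> l" "l \<le> 1" "g l = 0" "E = k * G l"
    unfolding E_def using eventually_monotone_orbit[OF k o s, of 0 1] by blast
  then have "l = \<alpha>" using g_zero_cases[of l] E0 G_0 by (auto simp: E_def)
  then have "E < 0" using l(4) G_neg[of \<alpha>] \<alpha> k by (simp add: mult_pos_neg)
  then show False using E0 by (simp add: E_def)
qed

end

section \<open>Orbits glued at the jump\<close>

text \<open>Both halves are read as forward orbits issuing from the jump, the left one with time and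
  momentum reversed. They share the values of \<open>v\<close> and \<open>w\<close> at the jump, but
  \<open>w\<close> may have a corner there.\<close>

definition step_orbit ::
    "(real \<Rightarrow> real) \<Rightarrow> real \<Rightarrow> real \<Rightarrow> real \<Rightarrow> (real \<Rightarrow> real) \<Rightarrow> (real \<Rightarrow> real) \<Rightarrow> bool" where
  "step_orbit g k\<^sub>1 k\<^sub>2 t\<^sub>0 v w \<longleftrightarrow>
    half_orbit g k\<^sub>1 (\<lambda>s. v (t\<^sub>0 - s)) (\<lambda>s. - w (t\<^sub>0 - s)) \<and>
    half_orbit g k\<^sub>2 (\<lambda>s. v (t\<^sub>0 + s)) (\<lambda>s. w (t\<^sub>0 + s))"

lemma step_orbit_exists:
  assumes "L-lipschitz_on UNIV g"
  shows "\<exists>v w. step_orbit g k\<^sub>1 k\<^sub>2 t\<^sub>0 v w \<and> v t\<^sub>0 = \<rho> \<and> w t\<^sub>0 = \<omega>"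
proof -
  obtain x1 w1 where 1: "half_orbit g k\<^sub>1 x1 w1" "x1 0 = \<rho>" "w1 0 = - \<omega>"
    using half_orbit_exists[OF assms] by blast
  obtain x2 w2 where 2: "half_orbit g k\<^sub>2 x2 w2" "x2 0 = \<rho>" "w2 0 = \<omega>"
    using half_orbit_exists[OF assms] by blast
  define v where "v t = (if t < t\<^sub>0 then x1 (t\<^sub>0 - t) else x2 (t - t\<^sub>0))" for t
  define w where "w t = (if t < t\<^sub>0 then - w1 (t\<^sub>0 - t) else w2 (t - t\<^sub>0))" for t
  have cong: "half_orbit g k x' w'"
    if "half_orbit g k x z" and eq: "\<And>t. t \<ge> 0 \<Longrightarrow> x' t = x t" "\<And>t. t \<ge> 0 \<Longrightarrow> w' t = z t" for k x z x' w'
    unfolding half_orbit_def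
  proof (intro allI impI conjI)
    fix t :: real assume t: "t \<ge> 0"
    show "(x' has_real_derivative velocity (w' t)) (at t within {0..})"
      by (rule has_field_derivative_transform_within[of x _ t _ 1])
        (use half_orbitD(1)[OF that(1) t] t eq in auto)
    show "(w' has_real_derivative - k * g (x' t)) (at t within {0..})"
      by (rule has_field_derivative_transform_within[of z _ t _ 1])
        (use half_orbitD(2)[OF that(1) t] t eq in auto)
  qed
  have "step_orbit g k\<^sub>1 k\<^sub>2 t\<^sub>0 v w"
    unfolding step_orbit_def
  proof
    show "half_orbit g k\<^sub>1 (\<lambda>s. v (t\<^sub>0 - s)) (\<lambda>s. - w (t\<^sub>0 - s))"
      by (rule cong[OF 1(1)]) (use 1 2 in \<open>auto simp: v_def w_def\<close>)
    show "half_orbit g k\<^sub>2 (\<lambda>s. v (t\<^sub>0 + s)) (\<lambda>s. w (t\<^sub>0 + s))"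
      by (rule cong[OF 2(1)]) (auto simp: v_def w_def)
  qed
  then show ?thesis using 2 by (intro exI[of _ v] exI[of _ w]) (simp add: v_def w_def)
qed

lemma DERIV_ray_left:
  assumes "((\<lambda>s. h (a - s)) has_real_derivative D) (at (a - t) within {0..})"
  shows "(h has_real_derivative - D) (at t within {..a})"
proof -
  have "(\<lambda>u. a - u) ` {..a} = {0..}"
    by (auto simp: image_iff intro!: bexI[of _ "a - _"])
  then have "((\<lambda>s. h (a - s)) has_real_derivative D) (at (a - t) within (\<lambda>u. a - u) ` {..a})"
    using assms by simp
  moreover have "((\<lambda>u. a - u) has_real_derivative -1) (at t within {..a})"
    by (auto intro!: derivative_eq_intros)
  ultimately show ?thesis
    using DERIV_image_chain[of "\<lambda>s. h (a - s)" D "\<lambda>u. a - u" t "{..a}" "-1"] by (simp add: o_def)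
qed

lemma DERIV_ray_right:
  assumes "((\<lambda>s. h (a + s)) has_real_derivative D) (at (t - a) within {0..})"
  shows "(h has_real_derivative D) (at t within {a..})"
proof -
  have "(\<lambda>u. u - a) ` {a..} = {0..}"
    by (auto simp: image_iff intro!: bexI[of _ "_ + a"])
  then have "((\<lambda>s. h (a + s)) has_real_derivative D) (at (t - a) within (\<lambda>u. u - a) ` {a..})"
    using assms by simp
  moreover have "((\<lambda>u. u - a) has_real_derivative 1) (at t within {a..})"
    by (auto intro!: derivative_eq_intros)
  ultimately show ?thesis
    using DERIV_image_chain[of "\<lambda>s. h (a + s)" D "\<lambda>u. u - a" t "{a..}" 1] by (simp add: o_def)
qed

lemma DERIV_rays:
  assumes "(h has_real_derivative D) (at a within {..a})" "(h has_real_derivative D) (at a within {a..})"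
  shows "(h has_real_derivative D) (at a)"
proof -
  have "((\<lambda>y. (h y - h a) / (y - a)) \<longlongrightarrow> D) (at a within {..a} \<union> {a..})"
    using assms unfolding has_field_derivative_iff by (rule Lim_Un)
  moreover have "{..a} \<union> {a..} = UNIV" by auto
  ultimately show ?thesis by (simp add: has_field_derivative_iff)
qed

text \<open>The coefficient enters only the derivative of \<open>w\<close>: at the jump both
  one-sided derivatives of \<open>v\<close> agree, whereas those of \<open>w\<close> in general
  differ.\<close>

lemma step_orbit_deriv:
  assumes "step_orbit g k\<^sub>1 k\<^sub>2 t\<^sub>0 v w"
  shows "(v has_real_derivative velocity (w t)) (at t)"
    and "t < t\<^sub>0 \<Longrightarrow> (w has_real_derivative - k\<^sub>1 * g (v t)) (at t)"
    and "t > t\<^sub>0 \<Longrightarrow> (w has_real_derivative - k\<^sub>2 * g (v t)) (at t)"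
proof -
  note o = assms[unfolded step_orbit_def]
  have left: "(v has_real_derivative velocity (w t)) (at t within {..t\<^sub>0})"
    "(w has_real_derivative - k\<^sub>1 * g (v t)) (at t within {..t\<^sub>0})" if t: "t \<le> t\<^sub>0" for t
  proof -
    have "0 \<le> t\<^sub>0 - t" using t by simp
    note d = half_orbitD[OF conjunct1[OF o] this]
    show "(v has_real_derivative velocity (w t)) (at t within {..t\<^sub>0})"
      using DERIV_ray_left[OF d(1)] by simp
    show "(w has_real_derivative - k\<^sub>1 * g (v t)) (at t within {..t\<^sub>0})"
      using DERIV_minus[OF DERIV_ray_left[of "\<lambda>u. - w u", OF d(2)]] by simp
  qed
  have right: "(v has_real_derivative velocity (w t)) (at t within {t\<^sub>0..})"
    "(w has_real_derivative - k\<^sub>2 * g (v t)) (at t within {t\<^sub>0..})" if "t \<ge> t\<^sub>0" for t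
    using half_orbitD[OF conjunct2[OF o], of "t - t\<^sub>0"] that
    by (auto intro!: DERIV_ray_right)
  have inl: "at t within {..t\<^sub>0} = at t" if "t < t\<^sub>0" for t
    using that by (intro at_within_interior) simp
  have inr: "at t within {t\<^sub>0..} = at t" if "t > t\<^sub>0" for t
    using that by (intro at_within_interior) (simp add: interior_real_atLeast)
  show "t < t\<^sub>0 \<Longrightarrow> (w has_real_derivative - k\<^sub>1 * g (v t)) (at t)" using left(2)[of t] inl[of t] by simp
  show "t > t\<^sub>0 \<Longrightarrow> (w has_real_derivative - k\<^sub>2 * g (v t)) (at t)" using right(2)[of t] inr[of t] by simp
  show "(v has_real_derivative velocity (w t)) (at t)"
    using left(1)[of t] right(1)[of t] inl[of t] inr[of t] DERIV_rays[of v "velocity (w t)" t]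
    by (cases t t\<^sub>0 rule: linorder_cases) auto
qed

lemma half_orbit_lipschitz:
  assumes o: "half_orbit g k x w" and B: "\<And>y. \<bar>g y\<bar> \<le> B"
  shows "(\<bar>k\<bar> * B)-lipschitz_on {0..} w"
proof (rule bounded_derivative_imp_lipschitz)
  have "B \<ge> 0" using B[of 0] by linarith
  then show "0 \<le> \<bar>k\<bar> * B" by simp
  fix t :: real assume "t \<in> {0..}"
  then show "(w has_derivative (*) (- k * g (x t))) (at t within {0..})"
    using half_orbitD(2)[OF o, of t] by (simp add: has_field_derivative_def)
  show "onorm ((*) (- k * g (x t))) \<le> \<bar>k\<bar> * B"
  proof (rule onorm_le)
    fix y :: real
    have "\<bar>k\<bar> * \<bar>g (x t)\<bar> \<le> \<bar>k\<bar> * B" using B by (intro mult_left_mono) auto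
    then have "\<bar>k\<bar> * \<bar>g (x t)\<bar> * \<bar>y\<bar> \<le> \<bar>k\<bar> * B * \<bar>y\<bar>" by (intro mult_right_mono) auto
    then show "norm (- k * g (x t) * y) \<le> \<bar>k\<bar> * B * norm y" by (simp add: abs_mult)
  qed
qed simp

text \<open>Source of the absolute continuity of v', which is \<open>velocity\<close> composed with
  \<open>w\<close>. Across the jump the increment is split at \<open>t\<^sub>0\<close>.\<close>

lemma step_orbit_lipschitz:
  assumes o: "step_orbit g k\<^sub>1 k\<^sub>2 t\<^sub>0 v w" and B: "\<And>y. \<bar>g y\<bar> \<le> B"
  shows "((\<bar>k\<^sub>1\<bar> + \<bar>k\<^sub>2\<bar>) * B)-lipschitz_on UNIV w"
proof (rule lipschitz_on_leI)
  let ?C = "(\<bar>k\<^sub>1\<bar> + \<bar>k\<^sub>2\<bar>) * B"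
  have B0: "B \<ge> 0" using B[of 0] by linarith
  then show "0 \<le> ?C" by simp
  have C: "\<bar>k\<^sub>1\<bar> * B \<le> ?C" "\<bar>k\<^sub>2\<bar> * B \<le> ?C" using B0 by (auto intro!: mult_right_mono)
  note o' = o[unfolded step_orbit_def]
  have left: "\<bar>w y - w x\<bar> \<le> ?C * (y - x)" if "x \<le> y" "y \<le> t\<^sub>0" for x y
  proof -
    have "\<bar>w y - w x\<bar> \<le> \<bar>k\<^sub>1\<bar> * B * (y - x)"
      using lipschitz_onD[OF half_orbit_lipschitz[OF conjunct1[OF o'] B], of "t\<^sub>0 - x" "t\<^sub>0 - y"] that
      by (simp add: dist_real_def)
    also have "\<dots> \<le> ?C * (y - x)" by (rule mult_right_mono) (use C that in auto)
    finally show ?thesis .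
  qed
  have right: "\<bar>w y - w x\<bar> \<le> ?C * (y - x)" if "x \<le> y" "t\<^sub>0 \<le> x" for x y
  proof -
    have "\<bar>w y - w x\<bar> \<le> \<bar>k\<^sub>2\<bar> * B * (y - x)"
      using lipschitz_onD[OF half_orbit_lipschitz[OF conjunct2[OF o'] B], of "y - t\<^sub>0" "x - t\<^sub>0"] that
      by (simp add: dist_real_def)
    also have "\<dots> \<le> ?C * (y - x)" by (rule mult_right_mono) (use C that in auto)
    finally show ?thesis .
  qed
  fix x y :: real assume "x \<le> y"
  have "\<bar>w y - w x\<bar> \<le> ?C * (y - x)"
  proof (cases "x \<le> t\<^sub>0 \<and> t\<^sub>0 \<le> y")
    case True
    have "\<bar>w y - w x\<bar> \<le> ?C * (y - t\<^sub>0) + ?C * (t\<^sub>0 - x)"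
      using right[of t\<^sub>0 y] left[of x t\<^sub>0] True by linarith
    also have "\<dots> = ?C * (y - x)" by (simp add: algebra_simps)
    finally show ?thesis .
  qed (use left[of x y] right[of x y] \<open>x \<le> y\<close> in auto)
  then show "dist (w x) (w y) \<le> ?C * dist x y"
    using \<open>x \<le> y\<close> by (simp add: dist_real_def abs_minus_commute)
qed

text \<open>Since \<open>momentum\<close> inverts \<open>velocity\<close>, the differentiated
  quotient is \<open>w\<close> itself; the equation can fail only at the jump, a null set.\<close>

lemma step_orbit_imp_extended_solution:
  assumes o: "step_orbit (zero_extension f) (c\<^sub>1 / \<delta>) (c\<^sub>2 / \<delta>) t\<^sub>0 v w" and \<delta>: "\<delta> > 0"
    and B: "\<And>y. \<bar>zero_extension f y\<bar> \<le> B" and q: "\<And>t. q t = (if t < t\<^sub>0 then c\<^sub>1 else c\<^sub>2)"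
  shows "extended_solution \<delta> q f v"
proof -
  have der: "deriv v t = velocity (w t)" for t
    by (rule DERIV_imp_deriv[OF step_orbit_deriv(1)[OF o]])
  then have d: "deriv v = (\<lambda>t. velocity (w t))" by blast
  note lip = step_orbit_lipschitz[OF o B]
  have "continuous_on UNIV (\<lambda>t. velocity (w t))"
    by (intro continuous_intros lipschitz_on_continuous_on[OF lip])
  then have C1: "v C1_differentiable_on UNIV"
    unfolding C1_differentiable_on_def using step_orbit_deriv(1)[OF o]
    by (intro exI[of _ "\<lambda>t. velocity (w t)"])
      (simp add: has_real_derivative_iff_has_vector_derivative)
  obtain C where C: "C-lipschitz_on UNIV (\<lambda>t. velocity (w t))"
    using lipschitz_on_compose2[OF lip lipschitz_on_subset[OF velocity_lipschitz]] by blast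
  have ac: "abs_continuous (deriv v)"
    unfolding abs_continuous_def d
    using lipschitz_imp_abs_continuous_on_interval lipschitz_on_subset[OF C] by blast
  define Q where "Q t \<longleftrightarrow> (\<exists>D. ((\<lambda>s. deriv v s / sqrt (1 - (deriv v s)\<^sup>2)) has_real_derivative D) (at t) \<and>
      \<delta> * D + q t * zero_extension f (v t) = 0)" for t
  have "Q t" if "t \<noteq> t\<^sub>0" for t
  proof -
    have "(\<lambda>s. deriv v s / sqrt (1 - (deriv v s)\<^sup>2)) = w"
      using momentum_velocity by (simp add: d momentum_def[symmetric])
    moreover have "(w has_real_derivative - (q t / \<delta>) * zero_extension f (v t)) (at t)"
      using step_orbit_deriv(2,3)[OF o, of t] that q by (cases "t < t\<^sub>0") auto
    ultimately show ?thesis using \<delta> by (auto simp: Q_def)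
  qed
  then have "{t \<in> space lebesgue. \<not> Q t} \<subseteq> {t\<^sub>0}" by blast
  moreover have "{t\<^sub>0} \<in> null_sets lebesgue" by (metis negligible_iff_null_sets negligible_sing)
  ultimately have "AE t in lebesgue. Q t" by (intro AE_I')
  then show ?thesis
    unfolding extended_solution_def Q_def using C1 ac velocity_less_one der by simp
qed

text \<open>\<open>momentum\<close> blows up at -1 and 1, so it is Lipschitz only on smaller
  intervals. This suffices: on a compact time interval |v'| attains a maximum below 1, which serves
  as \<open>m\<close>.\<close>

lemma momentum_lipschitz:
  assumes m: "0 \<le> m" "m < 1"
  shows "(1 / sqrt (1 - m\<^sup>2) ^ 3)-lipschitz_on {-m..m} momentum"
proof (rule bounded_derivative_imp_lipschitz)
  have m2: "m\<^sup>2 < 1" using m by (simp add: abs_square_less_1)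
  then show "0 \<le> 1 / sqrt (1 - m\<^sup>2) ^ 3" by simp
  fix p assume p: "p \<in> {-m..m}"
  show "(momentum has_derivative (*) (1 / sqrt (1 - p\<^sup>2) ^ 3)) (at p within {-m..m})"
    using momentum_deriv[of p] p m
    by (auto simp: has_field_derivative_def intro: has_derivative_at_withinI)
  have "\<bar>p\<bar> \<le> m" using p by auto
  then have p2: "p\<^sup>2 \<le> m\<^sup>2" by (metis abs_ge_zero power2_abs power_mono)
  show "onorm ((*) (1 / sqrt (1 - p\<^sup>2) ^ 3)) \<le> 1 / sqrt (1 - m\<^sup>2) ^ 3"
  proof (rule onorm_le)
    fix y :: real
    have "1 / sqrt (1 - p\<^sup>2) ^ 3 \<le> 1 / sqrt (1 - m\<^sup>2) ^ 3"
      using p2 m2 by (intro divide_left_mono power_mono mult_pos_pos) auto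
    then have "1 / sqrt (1 - p\<^sup>2) ^ 3 * \<bar>y\<bar> \<le> 1 / sqrt (1 - m\<^sup>2) ^ 3 * \<bar>y\<bar>"
      by (intro mult_right_mono) auto
    then show "norm (1 / sqrt (1 - p\<^sup>2) ^ 3 * y) \<le> 1 / sqrt (1 - m\<^sup>2) ^ 3 * norm y"
      using p2 m2 by (simp add: abs_mult)
  qed
qed auto

text \<open>The regularity step. \<open>w\<close> is absolutely continuous on compact intervals, and
  its almost-everywhere derivative is on each side a constant multiple of the continuous function
  \<open>zero_extension f (v t)\<close>; hence \<open>w\<close> is a constant plus a multiple of an
  antiderivative \<open>R\<close>.\<close>

lemma extended_solution_imp_step_orbit:
  assumes sol: "extended_solution \<delta> q f v" and \<delta>: "\<delta> > 0"
    and g: "continuous_on UNIV (zero_extension f)" and q: "\<And>t. q t = (if t < t\<^sub>0 then c\<^sub>1 else c\<^sub>2)"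
  shows "\<exists>w. step_orbit (zero_extension f) (c\<^sub>1 / \<delta>) (c\<^sub>2 / \<delta>) t\<^sub>0 v w"
proof -
  let ?g = "zero_extension f"
  define w where "w t = momentum (deriv v t)" for t
  have lt1: "\<bar>deriv v t\<bar> < 1" for t using sol by (auto simp: extended_solution_def)
  have vel: "velocity (w t) = deriv v t" for t unfolding w_def by (rule velocity_momentum[OF lt1])
  obtain D where D: "\<And>t. (v has_vector_derivative D t) (at t)" "continuous_on UNIV D"
    using sol unfolding extended_solution_def C1_differentiable_on_def by auto
  have dD: "deriv v t = D t" for t
    using D(1) by (intro DERIV_imp_deriv) (simp add: has_real_derivative_iff_has_vector_derivative)
  have dv: "(v has_real_derivative deriv v t) (at t)" for t
    using D(1) dD by (simp add: has_real_derivative_iff_has_vector_derivative)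
  have contd: "continuous_on S (deriv v)" for S
    using D(2) dD by (metis continuous_on_subset subset_UNIV continuous_on_cong)
  have contv: "continuous_on UNIV v" using dv by (intro DERIV_continuous_on) auto
  have contgv: "continuous_on S (\<lambda>t. ?g (v t))" for S
    using continuous_on_compose2[OF g contv] continuous_on_subset by blast
  have "\<exists>R. \<forall>t::real. - \<infinity> < ereal t \<longrightarrow> ereal t < \<infinity> \<longrightarrow> (R has_vector_derivative ?g (v t)) (at t)"
    by (rule einterval_antiderivative) (use contgv[of UNIV] in \<open>auto simp: continuous_on_eq_continuous_at\<close>)
  then obtain R where R: "\<And>t. (R has_real_derivative ?g (v t)) (at t)"
    by (auto simp: has_real_derivative_iff_has_vector_derivative)
  have acw: "abs_continuous_on_interval a b w" if "a \<le> b" for a b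
  proof -
    have cont: "continuous_on {a..b} (\<lambda>t. \<bar>deriv v t\<bar>)" by (intro continuous_intros contd)
    have "{a..b} \<noteq> {}" using that by simp
    then obtain s where s: "s \<in> {a..b}" "\<And>t. t \<in> {a..b} \<Longrightarrow> \<bar>deriv v t\<bar> \<le> \<bar>deriv v s\<bar>"
      using continuous_attains_sup[OF compact_Icc _ cont] by blast
    have "deriv v ` {a..b} \<subseteq> {- \<bar>deriv v s\<bar>..\<bar>deriv v s\<bar>}" using s(2) by (force simp: abs_le_iff)
    note lip = lipschitz_on_subset[OF momentum_lipschitz[OF abs_ge_zero lt1] this]
    have "abs_continuous_on_interval a b (deriv v)"
      using sol that unfolding extended_solution_def abs_continuous_def by blast
    then show ?thesis
      unfolding w_def[abs_def] by (rule abs_continuous_on_interval_lipschitz_compose[OF _ lip])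
  qed
  have ae: "AE t in lebesgue. (w has_real_derivative - (q t / \<delta>) * ?g (v t)) (at t)"
  proof -
    have "AE t in lebesgue. \<exists>D. (w has_real_derivative D) (at t) \<and> \<delta> * D + q t * ?g (v t) = 0"
      using sol by (simp add: extended_solution_def w_def[abs_def] momentum_def)
    then show ?thesis
    proof eventually_elim
      case (elim t)
      then obtain D where D: "(w has_real_derivative D) (at t)" "\<delta> * D + q t * ?g (v t) = 0" by blast
      have "D = - (q t / \<delta>) * ?g (v t)" using D(2) \<delta> by (simp add: field_simps)
      then show ?case using D(1) by simp
    qed
  qed
  \<comment> \<open>The coefficient is prescribed only inside the interval: the left half ends at
    the jump, where \<open>q\<close> already has its right-hand value.\<close>
  have const: "w b + c / \<delta> * R b = w a + c / \<delta> * R a"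
    if "a \<le> b" "\<And>t. a < t \<Longrightarrow> t < b \<Longrightarrow> q t = c" for a b c
  proof -
    have "w b - (- (c / \<delta>) * R b) = w a - (- (c / \<delta>) * R a)"
    proof (rule abs_continuous_on_interval_antiderivative[OF that(1) acw[OF that(1)]])
      show "((\<lambda>t. - (c / \<delta>) * R t) has_real_derivative - (c / \<delta>) * ?g (v t)) (at t)" for t
        using R[of t] \<delta> by (auto intro!: derivative_eq_intros)
      show "continuous_on {a..b} (\<lambda>t. - (c / \<delta>) * ?g (v t))" by (intro continuous_intros contgv)
      show "AE t in lebesgue. t \<in> {a<..<b} \<longrightarrow> (w has_real_derivative - (c / \<delta>) * ?g (v t)) (at t)"
        using ae by eventually_elim (use that(2) in auto)
    qed
    then show ?thesis by simp
  qed
  have "step_orbit ?g (c\<^sub>1 / \<delta>) (c\<^sub>2 / \<delta>) t\<^sub>0 v w"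
    unfolding step_orbit_def half_orbit_def
  proof (intro conjI allI impI)
    fix s :: real assume s: "s \<ge> 0"
    have vt: "(v has_real_derivative velocity (w t)) (at t)" for t using dv vel by simp
    have reflect: "((\<lambda>u. t\<^sub>0 - u) has_real_derivative -1) (at s within {0..})"
      and shift: "((\<lambda>u. t\<^sub>0 + u) has_real_derivative 1) (at s within {0..})"
      by (auto intro!: derivative_eq_intros)
    show "((\<lambda>s. v (t\<^sub>0 - s)) has_real_derivative velocity (- w (t\<^sub>0 - s))) (at s within {0..})"
      using DERIV_chain2[OF vt reflect] by simp
    show "((\<lambda>s. v (t\<^sub>0 + s)) has_real_derivative velocity (w (t\<^sub>0 + s))) (at s within {0..})"
      using DERIV_chain2[OF vt shift] by simp
    have "((\<lambda>u. - (w t\<^sub>0 + c\<^sub>1 / \<delta> * (R t\<^sub>0 - R (t\<^sub>0 - u)))) has_real_derivative - (c\<^sub>1 / \<delta>) * ?g (v (t\<^sub>0 - s))) (at s within {0..})"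
      using DERIV_chain2[OF R reflect] \<delta> by (auto intro!: derivative_eq_intros)
    then show "((\<lambda>s. - w (t\<^sub>0 - s)) has_real_derivative - (c\<^sub>1 / \<delta>) * ?g (v (t\<^sub>0 - s))) (at s within {0..})"
    proof (rule has_field_derivative_transform_within[OF _ zero_less_one])
      fix u :: real assume "u \<in> {0..}"
      then show "- (w t\<^sub>0 + c\<^sub>1 / \<delta> * (R t\<^sub>0 - R (t\<^sub>0 - u))) = - w (t\<^sub>0 - u)"
        using const[of "t\<^sub>0 - u" t\<^sub>0 c\<^sub>1] q by (simp add: algebra_simps)
    qed (use s in auto)
    have "((\<lambda>u. w t\<^sub>0 + c\<^sub>2 / \<delta> * (R t\<^sub>0 - R (t\<^sub>0 + u))) has_real_derivative - (c\<^sub>2 / \<delta>) * ?g (v (t\<^sub>0 + s))) (at s within {0..})"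
      using DERIV_chain2[OF R shift] \<delta> by (auto intro!: derivative_eq_intros)
    then show "((\<lambda>s. w (t\<^sub>0 + s)) has_real_derivative - (c\<^sub>2 / \<delta>) * ?g (v (t\<^sub>0 + s))) (at s within {0..})"
    proof (rule has_field_derivative_transform_within[OF _ zero_less_one])
      fix u :: real assume "u \<in> {0..}"
      then show "w t\<^sub>0 + c\<^sub>2 / \<delta> * (R t\<^sub>0 - R (t\<^sub>0 + u)) = w (t\<^sub>0 + u)"
        using const[of t\<^sub>0 "t\<^sub>0 + u" c\<^sub>2] q by (simp add: algebra_simps)
    qed (use s in auto)
  qed
  then show ?thesis by blast
qed

section \<open>Limits at infinity under reflection and periodicity\<close>

lemma filterlim_diff_at_bot: "filterlim (\<lambda>s. a - s) at_bot at_top" for a :: real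
proof -
  have "filterlim (\<lambda>s. - a + s) at_top at_top"
    by (rule filterlim_tendsto_add_at_top[OF tendsto_const filterlim_ident])
  then show ?thesis by (simp add: filterlim_uminus_at_top)
qed

lemma tendsto_at_bot_reflect:
  fixes v :: "real \<Rightarrow> 'a::topological_space"
  shows "((\<lambda>s. v (a - s)) \<longlongrightarrow> l) at_top \<longleftrightarrow> (v \<longlongrightarrow> l) at_bot"
proof
  show "((\<lambda>s. v (a - s)) \<longlongrightarrow> l) at_top" if "(v \<longlongrightarrow> l) at_bot"
    using filterlim_compose[OF that filterlim_diff_at_bot] .
  have "filterlim (\<lambda>t. a - t) at_top at_bot"
    using filterlim_tendsto_add_at_top[OF tendsto_const filterlim_uminus_at_top_at_bot, of a] by simp
  then show "(v \<longlongrightarrow> l) at_bot" if "((\<lambda>s. v (a - s)) \<longlongrightarrow> l) at_top"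
    using filterlim_compose[OF that] by fastforce
qed

text \<open>Sampling along \<open>t + real n * T\<close> turns the limit into the value itself; this
  excludes periodic behaviour of a homoclinic.\<close>

lemma periodic_limit_imp_const:
  fixes v :: "real \<Rightarrow> real"
  assumes "periodic_from t\<^sub>0 v" and lim: "(v \<longlongrightarrow> l) at_top" and t: "t \<ge> t\<^sub>0"
  shows "v t = l"
proof -
  obtain T where T: "T > 0" "\<And>t. t \<ge> t\<^sub>0 \<Longrightarrow> v t = v (t + T)"
    using assms(1) by (auto simp: periodic_from_def)
  have per: "v (t + real n * T) = v t" for n
  proof (induction n)
    case (Suc n)
    have "t + real n * T \<ge> t\<^sub>0" using t T(1) by (simp add: add_increasing2)
    from T(2)[OF this] Suc show ?case by (simp add: algebra_simps)
  qed simp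
  have "filterlim (\<lambda>n. t + real n * T) at_top sequentially"
    using T(1) by (intro filterlim_tendsto_add_at_top[OF tendsto_const]
        filterlim_at_top_mult_tendsto_pos[OF tendsto_const _ filterlim_real_sequentially])
  from filterlim_compose[OF lim this] have "(\<lambda>n::nat. v t) \<longlonglongrightarrow> l" by (simp add: per)
  then show ?thesis by (simp add: tendsto_const_iff)
qed

section \<open>Glued orbits emanating from the equilibrium 0\<close>

context bistable
begin

text \<open>\<open>g\<close> vanishes at 0 and outside an interval of length 1, so its Lipschitz
  constant is also a bound.\<close>

lemma g_bounded: "\<bar>g y\<bar> \<le> L"
proof (cases "0 \<le> y \<and> y \<le> 1")
  case True
  have "\<bar>g y - g 0\<bar> \<le> L * \<bar>y - 0\<bar>" using lipschitz_onD[OF lip, of y 0] by (simp add: dist_real_def)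
  also have "\<dots> \<le> L * 1" using True lipschitz_on_nonneg[OF lip] by (intro mult_left_mono) auto
  finally show ?thesis using g_zero[of 0] by simp
next
  case False
  then show ?thesis using g_zero[of y] lipschitz_on_nonneg[OF lip] by auto
qed

lemma energy_uminus [simp]: "energy k x (- w) = energy k x w"
  by (simp add: energy_def)

text \<open>The reversed left half tends to 0, so it has zero energy and the range found for such
  orbits. A trivial left half would make the state at the jump the equilibrium 0, and the right half
  trivial as well.\<close>

lemma unstable_step_orbit:
  assumes k: "k\<^sub>1 > 0" and o: "step_orbit g k\<^sub>1 k\<^sub>2 t\<^sub>0 v w" and lim: "(v \<longlongrightarrow> 0) at_bot"
    and nontriv: "\<exists>t. v t \<noteq> 0"
  shows "energy k\<^sub>1 (v t\<^sub>0) (w t\<^sub>0) = 0" "0 < v t\<^sub>0" "v t\<^sub>0 \<le> \<beta>" "v t\<^sub>0 < 1"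
proof -
  note left = conjunct1[OF o[unfolded step_orbit_def]] and right = conjunct2[OF o[unfolded step_orbit_def]]
  have lim': "((\<lambda>s. v (t\<^sub>0 - s)) \<longlongrightarrow> 0) at_top" using lim by (simp add: tendsto_at_bot_reflect)
  show E: "energy k\<^sub>1 (v t\<^sub>0) (w t\<^sub>0) = 0" using vanishing_orbit_energy[OF k left lim'] by simp
  have "\<not> (\<forall>s\<ge>0. v (t\<^sub>0 - s) = 0)"
  proof
    assume z: "\<forall>s\<ge>0. v (t\<^sub>0 - s) = 0"
    have v0: "v t\<^sub>0 = 0" using z[rule_format, of 0] by simp
    then have w0: "w t\<^sub>0 = 0" using E by (simp add: energy_def G_0)
    have "v (t\<^sub>0 + s) = 0" if "s \<ge> 0" for s
      using half_orbit_equilibrium[OF right _ order_refl _ _ that, of 0] v0 w0 g_zero[of 0] by simp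
    from this[of "t - t\<^sub>0" for t] have "v t = 0" for t
      using z[rule_format, of "t\<^sub>0 - t"] by (cases "t \<le> t\<^sub>0") auto
    then show False using nontriv by blast
  qed
  then have "0 < v (t\<^sub>0 - 0) \<and> v (t\<^sub>0 - 0) \<le> \<beta> \<and> v (t\<^sub>0 - 0) < 1"
    using vanishing_orbit_range[OF k left lim'] by blast
  then show "0 < v t\<^sub>0" "v t\<^sub>0 \<le> \<beta>" "v t\<^sub>0 < 1" by auto
qed

lemma energy_jump:
  assumes "energy k\<^sub>1 x w = 0" shows "energy k\<^sub>2 x w = (k\<^sub>2 - k\<^sub>1) * G x"
  using assms by (simp add: energy_def algebra_simps)

text \<open>Used twice: for equal coefficients it provides the homoclinic, and for different ones it
  identifies a turning point at the jump with the excluded solution.\<close>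

lemma step_orbit_homoclinic:
  assumes k: "k\<^sub>1 > 0" "k\<^sub>2 > 0" and o: "step_orbit g k\<^sub>1 k\<^sub>2 t\<^sub>0 v w"
    and \<beta>: "\<beta> < 1" "v t\<^sub>0 = \<beta>" "w t\<^sub>0 = 0"
  shows "(v \<longlongrightarrow> 0) at_bot" "(v \<longlongrightarrow> 0) at_top" "strict_mono_on {..t\<^sub>0} v" "strict_antimono_on {t\<^sub>0..} v"
    "range v \<subseteq> {0..1}"
proof -
  note left = conjunct1[OF o[unfolded step_orbit_def]] and right = conjunct2[OF o[unfolded step_orbit_def]]
  note L = homoclinic_half_orbit[OF k(1) left \<beta>(1)] and R = homoclinic_half_orbit[OF k(2) right \<beta>(1)]
  show "(v \<longlongrightarrow> 0) at_bot" using L(1) \<beta> by (simp add: tendsto_at_bot_reflect)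
  show "(v \<longlongrightarrow> 0) at_top" using R(1) \<beta> tendsto_at_top_shift[of v t\<^sub>0] by (simp add: add.commute)
  show "strict_mono_on {..t\<^sub>0} v"
  proof (rule strict_mono_onI)
    fix r s assume "r \<in> {..t\<^sub>0}" "s \<in> {..t\<^sub>0}" "r < s"
    then show "v r < v s" using L(2)[of "t\<^sub>0 - s" "t\<^sub>0 - r"] \<beta> by simp
  qed
  show "strict_antimono_on {t\<^sub>0..} v"
  proof (rule monotone_onI)
    fix r s assume "r \<in> {t\<^sub>0..}" "s \<in> {t\<^sub>0..}" "r < s"
    then show "v s < v r" using R(2)[of "r - t\<^sub>0" "s - t\<^sub>0"] \<beta> by simp
  qed
  have E0: "energy k \<beta> 0 = 0" for k by (simp add: energy_def G_\<beta>)
  have pos: "0 < v t" for t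
    using zero_energy_orbit_pos[OF left, of "t\<^sub>0 - t"] zero_energy_orbit_pos[OF right, of "t - t\<^sub>0"] \<beta> E0 \<alpha>
    by (cases "t \<le> t\<^sub>0") auto
  have "v t \<le> \<beta>" for t
    using L(2)[of 0 "t\<^sub>0 - t"] R(2)[of 0 "t - t\<^sub>0"] \<beta> by (cases t t\<^sub>0 rule: linorder_cases) auto
  then show "range v \<subseteq> {0..1}" using pos \<alpha> by (force intro: less_imp_le order_trans)
qed

lemma step_orbit_heteroclinic:
  assumes k: "k\<^sub>1 > 0" "k\<^sub>2 > 0" and o: "step_orbit g k\<^sub>1 k\<^sub>2 t\<^sub>0 v w"
    and v0: "0 < v t\<^sub>0" "v t\<^sub>0 < \<beta>" "w t\<^sub>0 > 0"
    and E1: "energy k\<^sub>1 (v t\<^sub>0) (w t\<^sub>0) = 0" and E2: "energy k\<^sub>2 (v t\<^sub>0) (w t\<^sub>0) = k\<^sub>2 * G 1"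
  shows "(v \<longlongrightarrow> 0) at_bot" "(v \<longlongrightarrow> 1) at_top" "strict_mono v" "range v \<subseteq> {0..1}"
proof -
  note left = conjunct1[OF o[unfolded step_orbit_def]] and right = conjunct2[OF o[unfolded step_orbit_def]]
  have "(\<lambda>s. v (t\<^sub>0 - s)) 0 < \<beta>" "0 < (\<lambda>s. v (t\<^sub>0 - s)) 0" "(\<lambda>s. - w (t\<^sub>0 - s)) 0 < 0"
    "energy k\<^sub>1 ((\<lambda>s. v (t\<^sub>0 - s)) 0) ((\<lambda>s. - w (t\<^sub>0 - s)) 0) = 0"
    using v0 E1 by simp_all
  note L = decaying_half_orbit[OF k(1) left this(2,1,3,4)]
  have "(\<lambda>s. v (t\<^sub>0 + s)) 0 < 1" "0 < (\<lambda>s. v (t\<^sub>0 + s)) 0" "0 < (\<lambda>s. w (t\<^sub>0 + s)) 0"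
    "energy k\<^sub>2 ((\<lambda>s. v (t\<^sub>0 + s)) 0) ((\<lambda>s. w (t\<^sub>0 + s)) 0) = k\<^sub>2 * G 1"
    using v0 E2 \<alpha> by simp_all
  note R = front_half_orbit[OF k(2) right this(2,1,3,4)]
  show "(v \<longlongrightarrow> 0) at_bot" using L(1) by (simp add: tendsto_at_bot_reflect)
  show "(v \<longlongrightarrow> 1) at_top" using R(1) tendsto_at_top_shift[of v t\<^sub>0] by (simp add: add.commute)
  have l: "v r < v s" if "r < s" "s \<le> t\<^sub>0" for r s
    using L(2)[of "t\<^sub>0 - s" "t\<^sub>0 - r"] that by simp
  have r: "v r < v s" if "r < s" "t\<^sub>0 \<le> r" for r s
    using R(2)[of "r - t\<^sub>0" "s - t\<^sub>0"] that by simp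
  show mono: "strict_mono v"
  proof (rule strict_monoI)
    fix a b :: real assume "a < b"
    then consider "b \<le> t\<^sub>0" | "t\<^sub>0 \<le> a" | "a < t\<^sub>0" "t\<^sub>0 < b" by linarith
    then show "v a < v b"
      using l[of a b] r[of a b] less_trans[OF l[of a t\<^sub>0] r[of t\<^sub>0 b]] \<open>a < b\<close> by cases auto
  qed
  have "0 < v t \<and> v t < 1" for t
  proof -
    have "0 < v (min t t\<^sub>0)" using L(3)[of "t\<^sub>0 - min t t\<^sub>0"] by simp
    moreover have "v (max t t\<^sub>0) < 1" using R(3)[of "max t t\<^sub>0 - t\<^sub>0"] by simp
    moreover have "v (min t t\<^sub>0) \<le> v t" "v t \<le> v (max t t\<^sub>0)"
      using mono by (simp_all add: strict_mono_less_eq)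
    ultimately show ?thesis by linarith
  qed
  then show "range v \<subseteq> {0..1}" by (force intro: less_imp_le)
qed

lemma zero_energy_momentum:
  assumes "k > 0" "0 < \<rho>" "\<rho> < \<beta>"
  obtains \<omega> where "\<omega> > 0" "energy k \<rho> \<omega> = 0"
proof
  \<comment> \<open>The value of \<open>sqrt (1 + \<omega>\<^sup>2)\<close> that zero energy
    prescribes at height \<rho>; it exceeds 1 because \<open>G \<rho> < 0\<close>.\<close>
  define r where "r = 1 - k * G \<rho>"
  have r: "r > 1" using G_neg[of \<rho>] assms by (simp add: r_def mult_pos_neg)
  then have "r\<^sup>2 > 1" by (simp add: power_strict_mono one_less_power)
  then show "sqrt (r\<^sup>2 - 1) > 0" by simp
  show "energy k \<rho> (sqrt (r\<^sup>2 - 1)) = 0"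
    using \<open>r\<^sup>2 > 1\<close> r by (simp add: energy_def) (simp add: r_def)
qed

text \<open>At height \<beta> zero energy forces \<open>w = 0\<close>: for \<beta> < 1 this is the
  excluded peak, and \<beta> = 1 is never attained.\<close>

lemma unstable_step_orbit_less:
  assumes k: "k\<^sub>1 > 0" and o: "step_orbit g k\<^sub>1 k\<^sub>2 t\<^sub>0 v w" and lim: "(v \<longlongrightarrow> 0) at_bot"
    and nontriv: "\<exists>t. v t \<noteq> 0" and nopeak: "\<not> (\<beta> < 1 \<and> v t\<^sub>0 = \<beta> \<and> w t\<^sub>0 = 0)"
  shows "v t\<^sub>0 < \<beta>"
proof -
  note u = unstable_step_orbit[OF k o lim nontriv]
  have "w t\<^sub>0 = 0" if "v t\<^sub>0 = \<beta>" using u(1) that by (simp add: energy_def G_\<beta>)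
  then show ?thesis using nopeak u(3,4) by force
qed

lemma unstable_step_orbit_periodic:
  assumes k: "k\<^sub>1 > 0" "k\<^sub>1 < k\<^sub>2" and o: "step_orbit g k\<^sub>1 k\<^sub>2 t\<^sub>0 v w" and lim: "(v \<longlongrightarrow> 0) at_bot"
    and nopeak: "\<not> (\<beta> < 1 \<and> v t\<^sub>0 = \<beta> \<and> w t\<^sub>0 = 0)"
  shows "periodic_from t\<^sub>0 v"
proof (cases "\<exists>t. v t \<noteq> 0")
  case True
  note u = unstable_step_orbit[OF k(1) o lim True]
  have "G (v t\<^sub>0) < 0" using G_neg u(2) unstable_step_orbit_less[OF k(1) o lim True nopeak] by blast
  then have "energy k\<^sub>2 (v t\<^sub>0) (w t\<^sub>0) < 0" using energy_jump[OF u(1)] k by (simp add: mult_pos_neg)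
  then obtain T where T: "T > 0" "\<And>s. s \<ge> 0 \<Longrightarrow> v (t\<^sub>0 + s) = v (t\<^sub>0 + (s + T))"
    using negative_energy_periodic[OF _ conjunct2[OF o[unfolded step_orbit_def]]] k by auto
  have "v t = v (t + T)" if "t \<ge> t\<^sub>0" for t
    using T(2)[of "t - t\<^sub>0"] that by (simp add: algebra_simps)
  then show ?thesis using T(1) unfolding periodic_from_def by blast
\<comment> \<open>The trivial solution remains; any period will do, here 1.\<close>
qed (auto simp: periodic_from_def intro: exI[of _ 1])

text \<open>\<open>generic\<close>, applied to the height at the jump, keeps the new energy off the
  level of the equilibrium 1, the one positive level on which an orbit could stay inside for
  ever.\<close>

lemma unstable_step_orbit_exits:
  assumes k: "k\<^sub>2 > 0" "k\<^sub>2 < k\<^sub>1" and o: "step_orbit g k\<^sub>1 k\<^sub>2 t\<^sub>0 v w" and lim: "(v \<longlongrightarrow> 0) at_bot"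
    and nontriv: "\<exists>t. v t \<noteq> 0" and nopeak: "\<not> (\<beta> < 1 \<and> v t\<^sub>0 = \<beta> \<and> w t\<^sub>0 = 0)"
    and generic: "\<And>\<rho>. 0 < \<rho> \<Longrightarrow> \<rho> < \<beta> \<Longrightarrow> (k\<^sub>2 - k\<^sub>1) * G \<rho> \<noteq> k\<^sub>2 * G 1"
  shows "exits_transversally v"
proof -
  have k1: "k\<^sub>1 > 0" using k by simp
  note u = unstable_step_orbit[OF k1 o lim nontriv]
  have less: "v t\<^sub>0 < \<beta>" by (rule unstable_step_orbit_less[OF k1 o lim nontriv nopeak])
  then have "G (v t\<^sub>0) < 0" using G_neg u(2) by blast
  then have "energy k\<^sub>2 (v t\<^sub>0) (w t\<^sub>0) > 0" using energy_jump[OF u(1)] k by (simp add: mult_neg_neg)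
  moreover have "energy k\<^sub>2 (v t\<^sub>0) (w t\<^sub>0) \<noteq> k\<^sub>2 * G 1"
    using energy_jump[OF u(1)] generic[OF u(2) less] by simp
  ultimately obtain s where s: "v (t\<^sub>0 + s) = 0 \<or> v (t\<^sub>0 + s) = 1" "w (t\<^sub>0 + s) \<noteq> 0"
    using positive_energy_exits[OF k(1) conjunct2[OF o[unfolded step_orbit_def]]] u by auto
  have "deriv v (t\<^sub>0 + s) = velocity (w (t\<^sub>0 + s))"
    by (rule DERIV_imp_deriv[OF step_orbit_deriv(1)[OF o]])
  then show ?thesis using s unfolding exits_transversally_def by auto
qed

end

section \<open>From the given nonlinearity to the bistable system, and the theorem\<close>

lemma zero_extension_lipschitz:
  assumes lip: "L-lipschitz_on {0..1} f" and f: "f 0 = 0" "f 1 = 0"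
  shows "L-lipschitz_on UNIV (zero_extension f)"
proof (rule lipschitz_onI)
  \<comment> \<open>As \<open>f\<close> vanishes at both end points, extending by zero is the same
    as composing with the projection onto [0,1], which does not increase distances.\<close>
  have eq: "zero_extension f x = f (max 0 (min 1 x))" for x
    using f by (auto simp: zero_extension_def max_def min_def)
  fix x y :: real
  have "dist (zero_extension f x) (zero_extension f y) \<le> L * dist (max 0 (min 1 x)) (max 0 (min 1 y))"
    unfolding eq by (rule lipschitz_onD[OF lip]) auto
  also have "\<dots> \<le> L * dist x y"
    using lipschitz_on_nonneg[OF lip] by (intro mult_left_mono) (auto simp: dist_real_def)
  finally show "dist (zero_extension f x) (zero_extension f y) \<le> L * dist x y" .
qed (rule lipschitz_on_nonneg[OF lip])

lemma continuous_antiderivative: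
  fixes g :: "real \<Rightarrow> real"
  assumes "continuous_on UNIV g"
  shows "\<exists>G. G 0 = 0 \<and> (\<forall>x. (G has_real_derivative g x) (at x))"
proof -
  have "\<exists>R. \<forall>t::real. - \<infinity> < ereal t \<longrightarrow> ereal t < \<infinity> \<longrightarrow> (R has_vector_derivative g t) (at t)"
    by (rule einterval_antiderivative) (use assms in \<open>auto simp: continuous_on_eq_continuous_at\<close>)
  then obtain R where R: "\<And>t. (R has_real_derivative g t) (at t)"
    by (auto simp: has_real_derivative_iff_has_vector_derivative)
  have "((\<lambda>x. R x - R 0) has_real_derivative g x) (at x)" for x
    using R[of x] by (auto intro!: derivative_eq_intros)
  then show ?thesis by (intro exI[of _ "\<lambda>x. R x - R 0"]) simp
qed

theorem proposition1p1:
  fixes f F q :: "real \<Rightarrow> real" and \<alpha> \<delta> t\<^sub>0 c\<^sub>1 c\<^sub>2 :: real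
  assumes lip: "\<exists>L. L-lipschitz_on {0..1} f"
    and f0: "f 0 = 0" and f1: "f 1 = 0"
    and \<alpha>: "\<alpha> \<in> {0<..<1}" and f\<alpha>: "f \<alpha> = 0"
    and f_neg: "\<And>s. s \<in> {0<..<\<alpha>} \<Longrightarrow> f s < 0"
    and f_pos: "\<And>s. s \<in> {\<alpha><..<1} \<Longrightarrow> f s > 0"
    and F: "\<And>v. v \<in> {0..1} \<Longrightarrow> F v = integral {0..v} f"
    and \<delta>: "\<delta> > 0" and c1: "c\<^sub>1 > 0" and c2: "c\<^sub>2 > 0"
    and q: "\<And>t. q t = (if t < t\<^sub>0 then c\<^sub>1 else c\<^sub>2)"
  shows
    "(F 1 > 0 \<longrightarrow>
        (c\<^sub>2 > c\<^sub>1 \<longrightarrow>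
          (\<forall>v. extended_solution \<delta> q f v \<and> (v \<longlongrightarrow> 0) at_bot \<and>
               \<not> homoclinic_with_peak \<delta> q f t\<^sub>0 v
             \<longrightarrow> periodic_from t\<^sub>0 v)) \<and>
        (c\<^sub>2 = c\<^sub>1 \<longrightarrow>
          (\<exists>v. homoclinic \<delta> q f v \<and>
             (\<forall>w. homoclinic \<delta> q f w \<longrightarrow> (\<exists>\<tau>. \<forall>t. w t = v (t + \<tau>))))) \<and>
        (c\<^sub>2 < c\<^sub>1 \<and> (\<forall>\<rho>\<in>{0<..\<alpha>}. c\<^sub>2 \<noteq> c\<^sub>1 * (- F \<rho> / (F 1 - F \<rho>))) \<longrightarrow>
          (\<forall>v. extended_solution \<delta> q f v \<and> (v \<longlongrightarrow> 0) at_bot \<and> (\<exists>t. v t \<noteq> 0) \<and>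
               \<not> homoclinic_with_peak \<delta> q f t\<^sub>0 v
             \<longrightarrow> exits_transversally v)) \<and>
        ((\<exists>\<rho>\<in>{0<..\<alpha>}. c\<^sub>2 = c\<^sub>1 * (- F \<rho> / (F 1 - F \<rho>))) \<longrightarrow>
          (\<exists>v. heteroclinic \<delta> q f v))) \<and>
     (F 1 = 0 \<longrightarrow>
        (c\<^sub>2 > c\<^sub>1 \<longrightarrow>
          (\<forall>v. extended_solution \<delta> q f v \<and> (v \<longlongrightarrow> 0) at_bot \<longrightarrow> periodic_from t\<^sub>0 v) \<and>
          \<not> (\<exists>v. homoclinic \<delta> q f v)) \<and>
        (c\<^sub>2 = c\<^sub>1 \<longrightarrow> (\<exists>v. heteroclinic \<delta> q f v)) \<and>
        (c\<^sub>2 < c\<^sub>1 \<longrightarrow>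
          (\<forall>v. extended_solution \<delta> q f v \<and> (v \<longlongrightarrow> 0) at_bot \<and> (\<exists>t. v t \<noteq> 0)
             \<longrightarrow> exits_transversally v)))"
proof -
  define g where "g = zero_extension f"
  obtain L where L: "L-lipschitz_on {0..1} f" using lip by blast
  have glip: "L-lipschitz_on UNIV g" unfolding g_def using L f0 f1 by (rule zero_extension_lipschitz)
  have gcont: "continuous_on S g" for S
    using lipschitz_on_continuous_on[OF glip] continuous_on_subset by blast
  have g_zero: "g x = 0" if "x \<le> 0 \<or> x = \<alpha> \<or> 1 \<le> x" for x
    using that f0 f1 f\<alpha> by (auto simp: g_def zero_extension_def intro: antisym)
  have g_neg: "g x < 0" if "0 < x" "x < \<alpha>" for x
    using that f_neg[of x] \<alpha> by (simp add: g_def zero_extension_def)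
  have g_pos: "g x > 0" if "\<alpha> < x" "x < 1" for x
    using that f_pos[of x] \<alpha> by (simp add: g_def zero_extension_def)
  obtain G where G: "G 0 = 0" "\<And>x. (G has_real_derivative g x) (at x)"
    using continuous_antiderivative[OF gcont] by blast
  have Gcont: "continuous_on S G" for S
    using G(2) by (intro DERIV_continuous_on) (auto intro: DERIV_subset)
  \<comment> \<open>\<open>F\<close> is prescribed only on [0,1], whereas the phase plane analysis
    needs a potential on the whole line; the two agree where both are meaningful.\<close>
  have FG: "F x = G x" if "x \<in> {0..1}" for x
  proof -
    have "(f has_integral G x - G 0) {0..x}"
    proof (rule fundamental_theorem_of_calculus)
      fix s assume s: "s \<in> {0..x}"
      then have "g s = f s" using that by (simp add: g_def zero_extension_def)
      then show "(G has_vector_derivative f s) (at s within {0..x})"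
        using DERIV_subset[OF G(2)[of s]] by (simp add: has_real_derivative_iff_has_vector_derivative)
    qed (use that in simp)
    then show ?thesis using F[OF that] G(1) by (simp add: integral_unique)
  qed
  have "G \<alpha> < G 0"
    using \<alpha> G(2) g_neg by (intro DERIV_neg_imp_decreasing_open[OF _ _ Gcont]) force+
  then have G\<alpha>: "G \<alpha> < 0" using G(1) by simp
  have bistableI: "bistable g G \<alpha> \<beta> L" if "\<alpha> < \<beta>" "\<beta> \<le> 1" "G \<beta> = 0" for \<beta>
    using that \<alpha> G g_zero g_neg g_pos glip by unfold_locales auto
  define k\<^sub>1 where "k\<^sub>1 = c\<^sub>1 / \<delta>"
  define k\<^sub>2 where "k\<^sub>2 = c\<^sub>2 / \<delta>"
  have k: "k\<^sub>1 > 0" "k\<^sub>2 > 0" using c1 c2 \<delta> by (simp_all add: k\<^sub>1_def k\<^sub>2_def)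
  have k_less: "k\<^sub>1 < k\<^sub>2 \<longleftrightarrow> c\<^sub>1 < c\<^sub>2" "k\<^sub>2 < k\<^sub>1 \<longleftrightarrow> c\<^sub>2 < c\<^sub>1"
    using \<delta> by (simp_all add: k\<^sub>1_def k\<^sub>2_def divide_less_cancel)
  have to_orbit: "\<exists>w. step_orbit g k\<^sub>1 k\<^sub>2 t\<^sub>0 v w" if "extended_solution \<delta> q f v" for v
    using extended_solution_imp_step_orbit[OF that \<delta> gcont[unfolded g_def] q]
    by (simp add: g_def k\<^sub>1_def k\<^sub>2_def)
  \<comment> \<open>Condition \<open>E\<close> says that a zero-energy state at height \<rho> is
    lifted by the jump exactly to the level of 1.\<close>
  have heteroclinic: "\<exists>v. heteroclinic \<delta> q f v"
    if \<beta>: "\<alpha> < \<beta>" "\<beta> \<le> 1" "G \<beta> = 0" and \<rho>: "0 < \<rho>" "\<rho> < \<beta>" and E: "(k\<^sub>2 - k\<^sub>1) * G \<rho> = k\<^sub>2 * G 1" for \<beta> \<rho>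
  proof -
    interpret bistable g G \<alpha> \<beta> L using \<beta> by (rule bistableI)
    obtain \<omega> where \<omega>: "\<omega> > 0" "energy k\<^sub>1 \<rho> \<omega> = 0" using zero_energy_momentum[OF k(1) \<rho>] .
    obtain v w where o: "step_orbit g k\<^sub>1 k\<^sub>2 t\<^sub>0 v w" "v t\<^sub>0 = \<rho>" "w t\<^sub>0 = \<omega>"
      using step_orbit_exists[OF glip] by blast
    have "extended_solution \<delta> q f v"
      using step_orbit_imp_extended_solution[OF _ \<delta> g_bounded[unfolded g_def] q] o(1)
      by (simp add: g_def k\<^sub>1_def k\<^sub>2_def)
    moreover have "energy k\<^sub>2 \<rho> \<omega> = k\<^sub>2 * G 1" using energy_jump[OF \<omega>(2)] E by simp
    ultimately show ?thesis
      using step_orbit_heteroclinic[OF k o(1)] \<rho> \<omega> o(2,3)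
      unfolding heteroclinic_def solution_def by blast
  qed
  have nopeak: "\<not> (\<beta> < 1 \<and> v t\<^sub>0 = \<beta> \<and> w t\<^sub>0 = 0)"
    if \<beta>: "\<alpha> < \<beta>" "\<beta> \<le> 1" "G \<beta> = 0" and sol: "extended_solution \<delta> q f v" and o: "step_orbit g k\<^sub>1 k\<^sub>2 t\<^sub>0 v w"
      and no: "\<not> homoclinic_with_peak \<delta> q f t\<^sub>0 v" for \<beta> v w
  proof
    interpret bistable g G \<alpha> \<beta> L using \<beta> by (rule bistableI)
    assume "\<beta> < 1 \<and> v t\<^sub>0 = \<beta> \<and> w t\<^sub>0 = 0"
    then show False
      using step_orbit_homoclinic[OF k o] sol no unfolding homoclinic_with_peak_def solution_def by blast
  qed
  show ?thesis
  proof (intro conjI impI; (elim conjE)?)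
    assume F1: "F 1 > 0"
    then have G1: "G 1 > 0" using FG[of 1] by simp
    \<comment> \<open>The potential is negative at \<alpha> and positive at 1, so its zero in
      between is neither of these points.\<close>
    obtain \<beta> where \<beta>: "\<alpha> < \<beta>" "\<beta> < 1" "G \<beta> = 0"
    proof -
      obtain \<beta> where "\<alpha> \<le> \<beta>" "\<beta> \<le> 1" "G \<beta> = 0"
        using IVT'[of G \<alpha> 0 1] G\<alpha> G1 \<alpha> Gcont by auto
      then show ?thesis using that[of \<beta>] G\<alpha> G1 by (cases "\<beta> = \<alpha> \<or> \<beta> = 1") auto
    qed
    note \<beta>' = \<beta>(1) less_imp_le[OF \<beta>(2)] \<beta>(3)
    interpret bistable g G \<alpha> \<beta> L using \<beta>' by (rule bistableI)
    show "\<forall>v. extended_solution \<delta> q f v \<and> (v \<longlongrightarrow> 0) at_bot \<and> \<not> homoclinic_with_peak \<delta> q f t\<^sub>0 v \<longrightarrow> periodic_from t\<^sub>0 v"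
      if "c\<^sub>2 > c\<^sub>1"
      using to_orbit unstable_step_orbit_periodic[OF k(1)] nopeak[OF \<beta>'] that k_less by meson
    show "\<exists>v. homoclinic \<delta> q f v \<and> (\<forall>w. homoclinic \<delta> q f w \<longrightarrow> (\<exists>\<tau>. \<forall>t. w t = v (t + \<tau>)))"
      if eq: "c\<^sub>2 = c\<^sub>1"
    proof -
      have k_eq: "k\<^sub>1 = k\<^sub>2" using eq by (simp add: k\<^sub>1_def k\<^sub>2_def)
      obtain v z where o: "step_orbit g k\<^sub>1 k\<^sub>2 t\<^sub>0 v z" "v t\<^sub>0 = \<beta>" "z t\<^sub>0 = 0"
        using step_orbit_exists[OF glip] by blast
      have "extended_solution \<delta> q f v"
        using step_orbit_imp_extended_solution[OF _ \<delta> g_bounded[unfolded g_def] q] o(1)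
        by (simp add: g_def k\<^sub>1_def k\<^sub>2_def)
      then have "homoclinic \<delta> q f v"
        using step_orbit_homoclinic[OF k o(1) \<beta>(2) o(2,3)]
        unfolding homoclinic_def homoclinic_with_peak_def solution_def by blast
      moreover have "\<exists>\<tau>. \<forall>t. w t = v (t + \<tau>)" if hom: "homoclinic \<delta> q f w" for w
      proof -
        obtain p where p: "homoclinic_with_peak \<delta> q f p w" using hom by (auto simp: homoclinic_def)
        have sol: "extended_solution \<delta> q f w" "range w \<subseteq> {0..1}" and lim: "(w \<longlongrightarrow> 0) at_top"
          and inc: "strict_mono_on {..p} w" and dec: "strict_antimono_on {p..} w"
          using p by (auto simp: homoclinic_with_peak_def solution_def)
        \<comment> \<open>For equal coefficients the jump may be placed anywhere; placing it at the
          peak of \<open>w\<close> makes the two halves of \<open>w\<close> start there.\<close>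
        obtain y where y: "step_orbit g k\<^sub>1 k\<^sub>2 p w y"
          using extended_solution_imp_step_orbit[OF sol(1) \<delta> gcont[unfolded g_def], of p c\<^sub>1 c\<^sub>2] q eq
          by (auto simp: g_def k\<^sub>1_def k\<^sub>2_def)
        note left = conjunct1[OF y[unfolded step_orbit_def]] and right = conjunct2[OF y[unfolded step_orbit_def]]
        have "w (p - 1) < w p" using strict_mono_onD[OF inc, of "p - 1" p] by simp
        then have wp: "0 < w p" "w p \<le> 1" using sol(2) by (auto simp: subset_iff intro: le_less_trans)
        have le: "w t \<le> w p" for t
          using strict_mono_onD[OF inc, of t p] monotone_onD[OF dec, of p t] by (cases t p rule: linorder_cases) auto
        \<comment> \<open>The peak is a maximum, so the momentum vanishes there; with zero energy
          this puts the peak at height \<beta>, the same phase point as \<open>v\<close> at the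
          jump. Uniqueness on both halves then gives the translation.\<close>
        have "velocity (y p) = 0"
          using DERIV_local_max[OF step_orbit_deriv(1)[OF y, of p] zero_less_one] le by simp
        then have yp: "y p = 0" by simp
        have "((\<lambda>s. w (p + s)) \<longlongrightarrow> 0) at_top"
          using lim tendsto_at_top_shift[of w p] by (simp add: add.commute)
        from vanishing_orbit_energy[OF k(2) right this] have "G (w p) = 0"
          using yp k by (simp add: energy_def)
        then have w\<beta>: "w p = \<beta>" using G_neg[of "w p"] G_pos[of "w p"] wp \<beta>(2) by force
        note vo = o(1)[unfolded step_orbit_def]
        have r: "w (p + s) = v (t\<^sub>0 + s)" if "s \<ge> 0" for s
          using half_orbit_unique[OF glip right conjunct2[OF vo] order_refl _ _ that] w\<beta> yp o(2,3) by simp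
        have l: "w (p - s) = v (t\<^sub>0 - s)" if "s \<ge> 0" for s
          using half_orbit_unique[OF glip left conjunct1[OF vo] order_refl _ _ that] w\<beta> yp o(2,3) by simp
        have "w t = v (t + (t\<^sub>0 - p))" for t
          using r[of "t - p"] l[of "p - t"] by (cases "p \<le> t") (auto simp: algebra_simps)
        then show ?thesis by blast
      qed
      ultimately show ?thesis by blast
    qed
    show "\<forall>v. extended_solution \<delta> q f v \<and> (v \<longlongrightarrow> 0) at_bot \<and> (\<exists>t. v t \<noteq> 0) \<and> \<not> homoclinic_with_peak \<delta> q f t\<^sub>0 v
        \<longrightarrow> exits_transversally v"
      if less: "c\<^sub>2 < c\<^sub>1" and ne: "\<forall>\<rho>\<in>{0<..\<alpha>}. c\<^sub>2 \<noteq> c\<^sub>1 * (- F \<rho> / (F 1 - F \<rho>))"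
    proof -
      have generic: "(k\<^sub>2 - k\<^sub>1) * G \<rho> \<noteq> k\<^sub>2 * G 1" if \<rho>: "0 < \<rho>" "\<rho> < \<beta>" for \<rho>
      proof
        assume eq: "(k\<^sub>2 - k\<^sub>1) * G \<rho> = k\<^sub>2 * G 1"
        \<comment> \<open>The hypothesis covers only heights up to \<alpha>, but the jump may be
          crossed between \<alpha> and \<beta>; the same value of \<open>G\<close> is then also
          taken on the left branch.\<close>
        have "\<exists>\<rho>'. 0 < \<rho>' \<and> \<rho>' \<le> \<alpha> \<and> G \<rho>' = G \<rho>"
        proof (cases "\<rho> \<le> \<alpha>")
          case False
          have "G \<alpha> \<le> G \<rho>" "G \<rho> < 0" using G_\<alpha>_less[of \<rho>] False G_neg[OF \<rho>] by auto
          then obtain \<rho>' where "0 \<le> \<rho>'" "\<rho>' \<le> \<alpha>" "G \<rho>' = G \<rho>"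
            using IVT2'[of G \<alpha> "G \<rho>" 0] G(1) \<alpha> Gcont by auto
          moreover have "\<rho>' \<noteq> 0" using \<open>G \<rho>' = G \<rho>\<close> \<open>G \<rho> < 0\<close> G(1) by auto
          ultimately show ?thesis by (intro exI[of _ \<rho>']) simp
        qed (use \<rho> in auto)
        then obtain \<rho>' where \<rho>': "0 < \<rho>'" "\<rho>' \<le> \<alpha>" "G \<rho>' = G \<rho>" by blast
        have "G \<rho> < 0" using G_neg[OF \<rho>] .
        then have "G 1 - G \<rho> > 0" using G1 by simp
        moreover have "c\<^sub>2 * (G 1 - G \<rho>) = c\<^sub>1 * (- G \<rho>)"
          using eq \<delta> by (simp add: k\<^sub>1_def k\<^sub>2_def field_simps)
        ultimately have "c\<^sub>2 = c\<^sub>1 * (- G \<rho> / (G 1 - G \<rho>))" by (simp add: field_simps)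
        moreover have "F \<rho>' = G \<rho>" "F 1 = G 1" using FG[of \<rho>'] FG[of 1] \<rho>' \<alpha> by auto
        moreover have "c\<^sub>2 \<noteq> c\<^sub>1 * (- F \<rho>' / (F 1 - F \<rho>'))" using ne \<rho>' by simp
        ultimately show False by simp
      qed
      show ?thesis
        using to_orbit unstable_step_orbit_exits[OF k(2) _ _ _ _ _ generic] nopeak[OF \<beta>'] less k_less by meson
    qed
    show "\<exists>v. heteroclinic \<delta> q f v" if ex: "\<exists>\<rho>\<in>{0<..\<alpha>}. c\<^sub>2 = c\<^sub>1 * (- F \<rho> / (F 1 - F \<rho>))"
    proof -
      obtain \<rho> where \<rho>: "0 < \<rho>" "\<rho> \<le> \<alpha>" "c\<^sub>2 = c\<^sub>1 * (- F \<rho> / (F 1 - F \<rho>))" using ex by auto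
      have "F \<rho> = G \<rho>" "F 1 = G 1" using FG[of \<rho>] FG[of 1] \<rho> \<alpha> by auto
      moreover have "\<rho> < \<beta>" using \<rho> \<beta> by simp
      moreover have "G \<rho> < 0" using G_neg[of \<rho>] \<rho> \<beta> by simp
      \<comment> \<open>The denominator is positive, so it can be cleared.\<close>
      ultimately have "c\<^sub>2 * (G 1 - G \<rho>) = c\<^sub>1 * (- G \<rho>)" using \<rho>(3) G1 by simp
      then have "(k\<^sub>2 - k\<^sub>1) * G \<rho> = k\<^sub>2 * G 1" using \<delta> by (simp add: k\<^sub>1_def k\<^sub>2_def field_simps)
      then show ?thesis using heteroclinic[OF \<beta>' \<rho>(1) \<open>\<rho> < \<beta>\<close>] by blast
    qed
  next
    assume F1: "F 1 = 0"
    then have G1: "G 1 = 0" using FG[of 1] by simp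
    have \<beta>: "\<alpha> < 1" "1 \<le> (1::real)" "G 1 = 0" using \<alpha> G1 by auto
    \<comment> \<open>With \<beta> = 1 a turning point below 1 on the zero level is impossible, so
      no solution has to be excluded.\<close>
    interpret bistable g G \<alpha> 1 L using \<beta> by (rule bistableI)
    have per: "periodic_from t\<^sub>0 v" if "c\<^sub>2 > c\<^sub>1" "extended_solution \<delta> q f v" "(v \<longlongrightarrow> 0) at_bot" for v
      using to_orbit[OF that(2)] unstable_step_orbit_periodic[OF k(1) _ _ that(3)] that(1) k_less by blast
    then show "\<forall>v. extended_solution \<delta> q f v \<and> (v \<longlongrightarrow> 0) at_bot \<longrightarrow> periodic_from t\<^sub>0 v" if "c\<^sub>2 > c\<^sub>1"
      using that by blast
    show "\<not> (\<exists>v. homoclinic \<delta> q f v)" if less: "c\<^sub>2 > c\<^sub>1"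
    proof
      assume "\<exists>v. homoclinic \<delta> q f v"
      then obtain v p where v: "homoclinic_with_peak \<delta> q f p v" by (auto simp: homoclinic_def)
      then have "periodic_from t\<^sub>0 v" and lim: "(v \<longlongrightarrow> 0) at_top" and dec: "strict_antimono_on {p..} v"
        using per[OF less] by (auto simp: homoclinic_with_peak_def solution_def)
      \<comment> \<open>Beyond both the peak and the start of periodicity, the solution would be
        constant and strictly decreasing at once.\<close>
      then have "v (max p t\<^sub>0) = 0" "v (max p t\<^sub>0 + 1) = 0"
        using periodic_limit_imp_const[OF _ lim, of t\<^sub>0] by auto
      moreover have "v (max p t\<^sub>0 + 1) < v (max p t\<^sub>0)"
        by (rule monotone_onD[OF dec]) auto
      ultimately show False by simp
    qed
    \<comment> \<open>For equal coefficients and \<open>G 1 = 0\<close> the level condition reads 0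
      = 0, so any height in ]0,1[ serves; \<alpha> is one.\<close>
    show "\<exists>v. heteroclinic \<delta> q f v" if "c\<^sub>2 = c\<^sub>1"
      by (rule heteroclinic[OF \<beta>, of \<alpha>]) (use \<alpha> G1 that in \<open>auto simp: k\<^sub>1_def k\<^sub>2_def\<close>)
    show "\<forall>v. extended_solution \<delta> q f v \<and> (v \<longlongrightarrow> 0) at_bot \<and> (\<exists>t. v t \<noteq> 0) \<longrightarrow> exits_transversally v"
      if less: "c\<^sub>2 < c\<^sub>1"
    proof -
      have "(k\<^sub>2 - k\<^sub>1) * G \<rho> \<noteq> k\<^sub>2 * G 1" if "0 < \<rho>" "\<rho> < 1" for \<rho>
        using G_neg[OF that] G1 less k_less by auto
      then show ?thesis
        using to_orbit unstable_step_orbit_exits[OF k(2)] less k_less by (metis less_irrefl)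
    qed
  qed
qed

end
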